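(* Let $\Omega\subseteq\mathbb{R}^N$ be a bounded domain with boundary of class $C^2$ and let $\sigma\in(0,1)$. Let $f\in L^\infty_{\mathrm{loc}}(\Omega)$ be such that $$\mathrm{dist}(\cdot,\partial\Omega)^{2}f\ge\kappa\quad\text{in }\Omega,$$ for some $\kappa>0$. Then, for all $p$ with $1\le p<\frac1\sigma$, the problem $$\begin{cases}-\Delta u+\big|(-\Delta)^\sigma u\big|^{p-1}(-\Delta)^\sigma u=f&\text{in }\Omega,\\ u=0&\text{on }\partial\Omega,\\ u=0&\text{in }\mathbb{R}^N\setminus\overline{\Omega}\end{cases}$$ has no solution $u\in L^\infty(\mathbb{R}^N)\cap C^2(\Omega)\cap C^0(\overline{\Omega})$.
   Context: $\Delta$ is the classical Laplacian and $(-\Delta)^\sigma$ is the fractional Laplacian, defined pointwise by $$(-\Delta)^\sigma u(x):=c_{N,\sigma}\lim_{\varepsilon\downarrow0}\int_{\mathbb{R}^N\setminus B_\varepsilon(x)}\frac{u(x)-u(y)}{|x-y|^{N+2\sigma}}\,dy,$$ where $c_{N,\sigma}>0$ is the normalizing constant for which the Fourier symbol of $(-\Delta)^\sigma$ is $|\xi|^{2\sigma}$. $u\in C^0(\overline\Omega)$ means that $u|_{\overline\Omega}$ is continuous. *)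

theory Defs
  imports "HOL-Analysis.Analysis"
begin

text \<open>
  Euclidean space of dimension \<open>N\<close> is \<open>real ^ 'n\<close> with \<open>N = CARD('n)\<close>.
\<close>

definition C2_on :: "'a::real_normed_vector set \<Rightarrow> ('a \<Rightarrow> 'b::real_normed_vector) \<Rightarrow> bool" where
  "C2_on S f \<longleftrightarrow>
     (\<exists>(f' :: 'a \<Rightarrow> 'a \<Rightarrow>\<^sub>L 'b) (f'' :: 'a \<Rightarrow> 'a \<Rightarrow>\<^sub>L 'a \<Rightarrow>\<^sub>L 'b).
        (\<forall>x\<in>S. (f has_derivative blinfun_apply (f' x)) (at x) \<and>
               (f' has_derivative blinfun_apply (f'' x)) (at x)) \<and>
        continuous_on S f'')"

text \<open>
  Near each boundary point, and in suitable orthonormal coordinates whose last axis points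
  in the direction \<open>\<nu>\<close>, the set is the region above the graph of a \<open>C\<^sup>2\<close> function of the other
  coordinates. The function \<open>\<gamma>\<close> is only evaluated on the hyperplane orthogonal to \<open>\<nu>\<close>; having it
  defined and \<open>C\<^sup>2\<close> on the whole space is no restriction, because a function on the hyperplane
  extends constantly in the direction \<open>\<nu>\<close>.
\<close>

definition C2_boundary :: "(real ^ 'n) set \<Rightarrow> bool" where
  "C2_boundary \<Omega> \<longleftrightarrow>
     (\<forall>x\<^sub>0 \<in> frontier \<Omega>. \<exists>r>0. \<exists>\<nu> \<gamma>. norm \<nu> = 1 \<and> C2_on UNIV (\<gamma> :: real ^ 'n \<Rightarrow> real) \<and>
        \<Omega> \<inter> ball x\<^sub>0 r = {x \<in> ball x\<^sub>0 r. x \<bullet> \<nu> > \<gamma> (x - (x \<bullet> \<nu>) *\<^sub>R \<nu>)})"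

definition Linfty_on :: "(real ^ 'n) set \<Rightarrow> (real ^ 'n \<Rightarrow> real) \<Rightarrow> bool" where
  "Linfty_on S f \<longleftrightarrow>
     f \<in> borel_measurable (lebesgue_on S) \<and> (\<exists>M. AE x in lebesgue_on S. \<bar>f x\<bar> \<le> M)"

definition Linfty_loc :: "(real ^ 'n) set \<Rightarrow> (real ^ 'n \<Rightarrow> real) \<Rightarrow> bool" where
  "Linfty_loc \<Omega> f \<longleftrightarrow> (\<forall>K. compact K \<and> K \<subseteq> \<Omega> \<longrightarrow> Linfty_on K f)"

definition laplacian :: "(real ^ 'n \<Rightarrow> real) \<Rightarrow> real ^ 'n \<Rightarrow> real" where
  "laplacian u x = (\<Sum>i\<in>UNIV. (deriv ^^ 2) (\<lambda>t. u (x + t *\<^sub>R axis i 1)) 0)"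

text \<open>
  The fractional Laplacian without its normalizing constant. The codomain is general so that
  the operator can also be applied to complex plane waves.
\<close>

definition frac_laplacian_pv ::
  "real \<Rightarrow> (real ^ 'n \<Rightarrow> 'b::{banach, second_countable_topology}) \<Rightarrow> real ^ 'n \<Rightarrow> 'b" where
  "frac_laplacian_pv \<sigma> u x =
     Lim (at_right 0) (\<lambda>\<epsilon>. LINT y : - ball x \<epsilon> | lebesgue.
       (u x - u y) /\<^sub>R (norm (x - y) powr (real CARD('n) + 2 * \<sigma>)))"

text \<open>
  The operator is translation invariant, so its Fourier symbol is the factor by which it
  multiplies the plane wave with frequency \<open>\<xi>\<close>; for the normalized operator this factor is to be
  \<open>\<bar>\<xi>\<bar>\<close> to the power \<open>2 \<sigma>\<close>.
\<close>

definition frac_laplacian_const :: "'n::finite itself \<Rightarrow> real \<Rightarrow> real" where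
  "frac_laplacian_const _ \<sigma> = (THE c. c > 0 \<and>
     (\<forall>\<xi> x :: real ^ 'n. c *\<^sub>R frac_laplacian_pv \<sigma> (\<lambda>y. cis (\<xi> \<bullet> y)) x =
        (norm \<xi> powr (2 * \<sigma>)) *\<^sub>R cis (\<xi> \<bullet> x)))"

definition frac_laplacian :: "real \<Rightarrow> (real ^ 'n \<Rightarrow> real) \<Rightarrow> real ^ 'n \<Rightarrow> real" where
  "frac_laplacian \<sigma> u x = frac_laplacian_const TYPE('n) \<sigma> * frac_laplacian_pv \<sigma> u x"

end

theory Submission
  imports Defs
begin

text \<open>
  Since \<open>u\<close> is continuous and vanishes on the boundary, its oscillation on a ball of radius
  \<open>\<rho> = dist(x\<^sub>0, \<partial>\<Omega>) / 2\<close> around a point \<open>x\<^sub>0\<close> close to the boundary is as small as we like. Hence the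
  paraboloid \<open>- \<epsilon> \<rho>\<^bsup>-2\<^esup> |x - x\<^sub>0|\<^sup>2\<close>, up to a constant, touches \<open>u\<close> from below at some point at distance
  less than \<open>\<rho> / 2\<close> from \<open>x\<^sub>0\<close>. There \<open>- \<Delta> u \<le> C \<epsilon> \<rho>\<^bsup>-2\<^esup>\<close>, and since \<open>u\<close> is bounded, the fractional
  Laplacian of \<open>u\<close> is at most \<open>C \<rho>\<close> to the power \<open>- 2 \<sigma>\<close>. The equation bounds \<open>f\<close>, which is at least
  a multiple of \<open>\<kappa> \<rho>\<^bsup>-2\<^esup>\<close>, by \<open>C \<epsilon> \<rho>\<^bsup>-2\<^esup>\<close> plus \<open>C \<rho>\<close> to the power \<open>- 2 \<sigma> p\<close>. As \<open>\<sigma> p < 1\<close>, this is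
  impossible for small \<open>\<epsilon>\<close> and \<open>\<rho>\<close>. The argument is one-sided, so it needs the normalizing constant
  to be positive; this follows from the scaling and rotation invariance of the symbol.
\<close>

subsection \<open>Integrals of the singular kernel\<close>

text \<open>On the annulus \<open>norm (x - y)\<close> lies between \<open>R / 2\<close> and
  \<open>R\<close>, so the kernel exceeds \<open>R powr (e - d)\<close> by a factor of at most
  \<open>2 powr \<bar>e - d\<bar>\<close>, whatever the sign of the exponent. The volume of the ball
  supplies the missing \<open>R powr d\<close>.\<close>

lemma nn_integral_annulus_powr:
  fixes x :: "'a::euclidean_space" and e R :: real
  assumes "R > 0"
  defines "d \<equiv> real DIM('a)"
  shows "(\<integral>\<^sup>+ y. ennreal (norm (x - y) powr (e - d)) * indicator (ball x R - ball x (R / 2)) y \<partial>lborel)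
    \<le> ennreal (2 powr \<bar>e - d\<bar> * unit_ball_vol d * R powr e)"
proof -
  have le: "t powr (e - d) \<le> 2 powr \<bar>e - d\<bar> * R powr (e - d)" if "R / 2 \<le> t" "t < R" for t
  proof -
    have t: "t > 0" using that assms by auto
    have "\<bar>ln (t / R)\<bar> \<le> ln 2"
    proof -
      have "ln (t / R) \<le> 0" using t that assms by (auto simp: ln_le_zero_iff)
      moreover have "ln (1/2) \<le> ln (t / R)" using t that assms
        by (subst ln_le_cancel_iff) (auto simp: field_simps)
      moreover have "ln (1/2::real) = - ln 2" by (simp add: ln_div)
      ultimately show ?thesis by auto
    qed
    then have "\<bar>(e - d) * ln (t / R)\<bar> \<le> \<bar>e - d\<bar> * ln 2"
      unfolding abs_mult by (rule mult_left_mono) simp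
    then have "(e - d) * ln (t / R) \<le> \<bar>e - d\<bar> * ln 2" by linarith
    then have "(t / R) powr (e - d) \<le> 2 powr \<bar>e - d\<bar>"
      using t assms by (simp add: powr_def)
    then show ?thesis using t assms by (simp add: powr_divide field_simps)
  qed
  have "(\<integral>\<^sup>+ y. ennreal (norm (x - y) powr (e - d)) * indicator (ball x R - ball x (R / 2)) y \<partial>lborel)
    \<le> (\<integral>\<^sup>+ y. ennreal (2 powr \<bar>e - d\<bar> * R powr (e - d)) * indicator (ball x R) y \<partial>lborel)"
    by (intro nn_integral_mono) (auto simp: indicator_def dist_norm intro!: ennreal_leI le)
  also have "\<dots> = ennreal (2 powr \<bar>e - d\<bar> * R powr (e - d)) * emeasure lborel (ball x R)"
    by (subst nn_integral_cmult_indicator) auto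
  also have "\<dots> = ennreal (2 powr \<bar>e - d\<bar> * unit_ball_vol d * R powr e)"
    using assms by (simp add: emeasure_ball ennreal_mult' [symmetric] powr_diff powr_realpow)
  finally show ?thesis .
qed

text \<open>Covering by dyadic annuli bounds the integral by a series; overlaps are harmless for an
  upper bound. The centre may stay uncovered because \<open>0 powr _\<close> is 0. Shrinking radii
  will treat balls, growing radii their complements.\<close>

lemma kernel_integrable_from_annuli:
  fixes x :: "'a::euclidean_space" and e :: real
  assumes [measurable]: "S \<in> sets borel"
    and cover: "\<And>y. y \<in> S \<Longrightarrow> y \<noteq> x \<Longrightarrow> \<exists>k. y \<in> ball x (R k) - ball x (R k / 2)"
    and R: "\<And>k. R k > 0"
    and sm: "(\<lambda>k. R k powr e) sums s"
  defines "d \<equiv> real DIM('a)"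
  shows "integrable lebesgue (\<lambda>y. indicator S y * norm (x - y) powr (e - d))"
    and "(LINT y|lebesgue. indicator S y * norm (x - y) powr (e - d)) \<le> 2 powr \<bar>e - d\<bar> * unit_ball_vol d * s"
proof -
  let ?D = "2 powr \<bar>e - d\<bar> * unit_ball_vol d"
  let ?f = "\<lambda>y. ennreal (norm (x - y) powr (e - d))"
  let ?A = "\<lambda>k. ball x (R k) - ball x (R k / 2)"
  have "(\<integral>\<^sup>+ y. ennreal (indicator S y * norm (x - y) powr (e - d)) \<partial>lborel)
      \<le> (\<integral>\<^sup>+ y. (\<Sum>k. ?f y * indicator (?A k) y) \<partial>lborel)"
  proof (intro nn_integral_mono)
    fix y
    show "ennreal (indicator S y * norm (x - y) powr (e - d)) \<le> (\<Sum>k. ?f y * indicator (?A k) y)"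
    proof (cases "y \<in> S \<and> y \<noteq> x")
      case True
      then obtain k where k: "y \<in> ?A k" using cover by blast
      have "ennreal (indicator S y * norm (x - y) powr (e - d)) = (\<Sum>k\<in>{k}. ?f y * indicator (?A k) y)"
        using True k by simp
      also have "\<dots> \<le> (\<Sum>k. ?f y * indicator (?A k) y)"
        by (intro sum_le_suminf) auto
      finally show ?thesis .
    qed auto
  qed
  also have "\<dots> = (\<Sum>k. \<integral>\<^sup>+ y. ?f y * indicator (?A k) y \<partial>lborel)"
    by (intro nn_integral_suminf borel_measurable_times_ennreal borel_measurable_indicator) auto
  also have "\<dots> \<le> (\<Sum>k. ennreal (?D * R k powr e))"
    unfolding d_def by (intro suminf_le summableI nn_integral_annulus_powr R)
  also have "\<dots> = ennreal (?D * s)"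
    using sums_mult[OF sm, of ?D] by (subst suminf_ennreal2) (auto simp: sums_iff d_def)
  finally have *: "(\<integral>\<^sup>+ y. ennreal (indicator S y * norm (x - y) powr (e - d)) \<partial>lborel) \<le> ennreal (?D * s)" .
  have int: "integrable lborel (\<lambda>y. indicator S y * norm (x - y) powr (e - d))"
    using le_less_trans[OF *] by (intro integrableI_bounded) auto
  then show "integrable lebesgue (\<lambda>y. indicator S y * norm (x - y) powr (e - d))"
    by (subst integrable_completion) (auto dest: borel_measurable_integrable)
  have "s \<ge> 0" using sums_le[OF _ sums_zero sm] by auto
  have "ennreal (LINT y|lborel. indicator S y * norm (x - y) powr (e - d)) \<le> ennreal (?D * s)"
    using * int by (subst nn_integral_eq_integral[symmetric]) auto
  then have "(LINT y|lborel. indicator S y * norm (x - y) powr (e - d)) \<le> ?D * s"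
    using \<open>s \<ge> 0\<close> by (subst (asm) ennreal_le_iff) (auto simp: d_def)
  then show "(LINT y|lebesgue. indicator S y * norm (x - y) powr (e - d)) \<le> ?D * s"
    by (subst integral_completion) auto
qed

text \<open>With radii \<open>r * (1/2)^k\<close> the series over the annuli is geometric with ratio
  \<open>(1/2) powr e\<close>, which is below 1 because \<open>e > 0\<close>.\<close>

lemma ball_kernel:
  fixes e :: real
  assumes "e > 0"
  defines "d \<equiv> real DIM('a::euclidean_space)"
  shows "\<exists>C\<ge>0. \<forall>x::'a. \<forall>r>0.
    integrable lebesgue (\<lambda>y. indicator (ball x r) y * norm (x - y) powr (e - d)) \<and>
    (LINT y|lebesgue. indicator (ball x r) y * norm (x - y) powr (e - d)) \<le> C * r powr e"
proof -
  define s where "s = 1 / (1 - (1/2::real) powr e)"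
  have q: "0 < (1/2::real) powr e" "(1/2::real) powr e < 1"
    using assms by (auto simp: powr_less_one powr_def ln_div)
  have C: "2 powr \<bar>e - d\<bar> * unit_ball_vol d * s \<ge> 0"
    using q by (auto simp: s_def d_def)
  show ?thesis
  proof (intro exI[of _ "2 powr \<bar>e - d\<bar> * unit_ball_vol d * s"] conjI allI impI C)
    fix x :: 'a and r :: real assume r: "r > 0"
    have sm: "(\<lambda>k. (r * (1/2)^k) powr e) sums (s * r powr e)"
    proof -
      have "(r * (1/2)^k) powr e = r powr e * ((1/2) powr e)^k" for k
        using r by (simp add: powr_mult powr_power powr_powr flip: powr_realpow) (simp add: mult.commute)
      then show ?thesis
        using sums_mult[OF geometric_sums[of "(1/2::real) powr e"], of "r powr e"] q
        by (simp add: s_def mult.commute)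
    qed
    have cover: "\<exists>k. y \<in> ball x (r * (1/2)^k) - ball x (r * (1/2)^k / 2)" if "y \<in> ball x r" "y \<noteq> x" for y
    proof -
      have "0 < norm (x - y) / r" using that r by simp
      then obtain n where "(1/2::real)^n < norm (x - y) / r"
        using real_arch_pow_inv[of "norm (x - y) / r" "1/2"] by auto
      then have n: "r * (1/2)^n < norm (x - y)" using r by (simp add: field_simps)
      \<comment> \<open>The first index whose radius is at most the distance is not 0, as
        \<open>y\<close> lies in \<open>ball x r\<close>; its predecessor gives the annulus that
        contains \<open>y\<close>.\<close>
      define k where "k = (LEAST n. r * (1/2)^n \<le> norm (x - y))"
      have k: "r * (1/2)^k \<le> norm (x - y)"
        unfolding k_def by (rule LeastI[of _ n]) (use n in auto)
      have "k \<noteq> 0" using k that r by (auto simp: dist_norm intro!: Nat.gr0I)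
      then obtain j where j: "k = Suc j" using not0_implies_Suc by auto
      have "\<not> r * (1/2)^j \<le> norm (x - y)"
        using not_less_Least[of j "\<lambda>n. r * (1/2)^n \<le> norm (x - y)"] j by (auto simp: k_def)
      then show ?thesis using k j by (intro exI[of _ j]) (auto simp: dist_norm)
    qed
    show "integrable lebesgue (\<lambda>y. indicator (ball x r) y * norm (x - y) powr (e - d))"
      unfolding d_def by (rule kernel_integrable_from_annuli[OF _ cover _ sm]) (use r in auto)
    show "(LINT y|lebesgue. indicator (ball x r) y * norm (x - y) powr (e - d)) \<le> 2 powr \<bar>e - d\<bar> * unit_ball_vol d * s * r powr e"
      unfolding d_def mult.assoc[of _ s]
      by (rule kernel_integrable_from_annuli(2)[OF _ cover _ sm]) (use r in auto)
  qed
qed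

text \<open>Now the radii grow and the negative exponent makes the series geometric. Starting at
  \<open>2^Suc 0\<close> gives the first annulus the inner radius \<open>r\<close>; hence the
  numerator of \<open>s\<close>.\<close>

lemma outer_kernel:
  fixes e :: real
  assumes "e > 0"
  defines "d \<equiv> real DIM('a::euclidean_space)"
  shows "\<exists>C\<ge>0. \<forall>x::'a. \<forall>r>0.
    integrable lebesgue (\<lambda>y. indicator (- ball x r) y * norm (x - y) powr (- e - d)) \<and>
    (LINT y|lebesgue. indicator (- ball x r) y * norm (x - y) powr (- e - d)) \<le> C * r powr (- e)"
proof -
  define s where "s = 2 powr (-e) / (1 - 2 powr (-e))"
  have q: "0 < (2::real) powr (-e)" "(2::real) powr (-e) < 1"
    using assms by (auto simp: powr_less_one)
  have C: "2 powr \<bar>-e - d\<bar> * unit_ball_vol d * s \<ge> 0"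
    using q by (auto simp: s_def d_def)
  show ?thesis
  proof (intro exI[of _ "2 powr \<bar>-e - d\<bar> * unit_ball_vol d * s"] conjI allI impI C)
    fix x :: 'a and r :: real assume r: "r > 0"
    have sm: "(\<lambda>k. (r * 2^Suc k) powr (-e)) sums (s * r powr (-e))"
    proof -
      have "(r * 2^Suc k) powr (-e) = r powr (-e) * 2 powr (-e) * (2 powr (-e))^k" for k
      proof -
        have "(2 ^ Suc k) powr (-e) = (2::real) powr (-e) * (2 powr (-e))^k"
          by (simp add: powr_mult powr_power powr_powr flip: powr_realpow) (simp add: mult.commute)
        then show ?thesis using r by (simp only: powr_mult mult.assoc)
      qed
      then show ?thesis
        using sums_mult[OF geometric_sums[of "2 powr (-e)::real"], of "r powr (-e) * 2 powr (-e)"] q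
        by (simp add: s_def mult.commute)
    qed
    have cover: "\<exists>k. y \<in> ball x (r * 2^Suc k) - ball x (r * 2^Suc k / 2)" if "y \<in> - ball x r" for y
    proof -
      obtain n where "norm (x - y) / r < (2::real)^n"
        using real_arch_pow[of 2 "norm (x - y) / r"] by auto
      then have n: "norm (x - y) < r * 2^n" using r by (simp add: field_simps)
      define k where "k = (LEAST n. norm (x - y) < r * 2^n)"
      have k: "norm (x - y) < r * 2^k"
        unfolding k_def by (rule LeastI[of _ n]) (use n in auto)
      have "k \<noteq> 0" using k that r by (auto simp: dist_norm intro!: Nat.gr0I)
      then obtain j where j: "k = Suc j" using not0_implies_Suc by auto
      have "\<not> norm (x - y) < r * 2^j"
        using not_less_Least[of j "\<lambda>n. norm (x - y) < r * 2^n"] j by (auto simp: k_def)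
      then show ?thesis using k j by (intro exI[of _ j]) (auto simp: dist_norm)
    qed
    show "integrable lebesgue (\<lambda>y. indicator (- ball x r) y * norm (x - y) powr (- e - d))"
      unfolding d_def by (rule kernel_integrable_from_annuli[OF _ cover _ sm]) (use r in auto)
    show "(LINT y|lebesgue. indicator (- ball x r) y * norm (x - y) powr (- e - d)) \<le> 2 powr \<bar>-e - d\<bar> * unit_ball_vol d * s * r powr (-e)"
      unfolding d_def mult.assoc[of _ s]
      by (rule kernel_integrable_from_annuli(2)[OF _ cover _ sm]) (use r in auto)
  qed
qed

text \<open>
  The change of variables theorem of the library needs a well-ordered index type. Balls are mapped
  to balls of the same radius, so the Vitali covering theorem gives the result for every index type.
\<close>

lemma distr_lborel_orthogonal:
  fixes g :: "'a::euclidean_space \<Rightarrow> 'a"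
  assumes g: "orthogonal_transformation g"
  shows "distr lborel borel g = lborel"
proof (rule sym, rule lborel_eqI)
  have lin: "linear g" using g by (rule orthogonal_transformation_linear)
  have [measurable]: "g \<in> borel_measurable borel"
    using lin by (intro borel_measurable_continuous_onI linear_continuous_on) (simp add: linear_conv_bounded_linear)
  define h where "h = inv g"
  have gh: "g (h y) = y" "h (g y) = y" for y
    using orthogonal_transformation_bij[OF g] by (auto simp: h_def bij_def surj_f_inv_f)
  have h: "orthogonal_transformation h" unfolding h_def by (rule orthogonal_transformation_inv[OF g])
  have [measurable]: "h \<in> borel_measurable borel"
    using orthogonal_transformation_linear[OF h]
    by (intro borel_measurable_continuous_onI linear_continuous_on) (simp add: linear_conv_bounded_linear)
  have vim: "g -` S = h ` S" for S
  proof
    show "g -` S \<subseteq> h ` S" using gh(2) by (metis image_iff subsetI vimageE)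
  qed (auto simp: gh)
  \<comment> \<open>As \<open>g\<close> preserves distances, the preimage of a ball is a ball of the
    same radius. For negative \<open>r\<close> both are empty.\<close>
  have ball: "emeasure lborel (g -` ball c r) = emeasure lborel (ball c r)" for c r
  proof -
    have "g -` ball c r = ball (h c) r"
    proof -
      have "dist c (g y) = dist (h c) y" for y
        using orthogonal_transformation_norm[OF g, of "h c - y"] gh(1)[of c] linear_diff[OF lin]
        by (simp add: dist_norm)
      then show ?thesis by auto
    qed
    then show ?thesis
      by (cases "r \<ge> 0") (simp_all add: emeasure_ball ball_empty)
  qed
  fix l u :: 'a
  assume lu: "\<And>b. b \<in> Basis \<Longrightarrow> l \<bullet> b \<le> u \<bullet> b"
  \<comment> \<open>This is the fineness that Vitali's theorem requires: each point of the box is in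
    arbitrarily small balls of the family. The index of a ball is the pair of its centre and
    radius.\<close>
  have "\<exists>i. i \<in> {i. ball (fst i) (snd i) \<subseteq> box l u} \<and> x \<in> ball (fst i) (snd i) \<and> snd i < d"
    if x: "x \<in> box l u" and "d > 0" for x d
  proof -
    obtain k where "k > 0" "ball x k \<subseteq> box l u"
      using x open_box by (meson open_contains_ball)
    then show ?thesis using \<open>d > 0\<close>
      by (intro exI[of _ "(x, min k (d/2))"]) (auto simp: min_def subset_iff)
  qed
  then obtain C where C: "countable C" "C \<subseteq> {i. ball (fst i) (snd i) \<subseteq> box l u}"
      and dis: "pairwise (\<lambda>i j. disjnt (ball (fst i) (snd i)) (ball (fst j) (snd j))) C"
      and neg: "negligible (box l u - (\<Union>i\<in>C. ball (fst i) (snd i)))"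
    using Vitali_covering_theorem_balls[where S="box l u" and a=fst and r=snd] by (metis (no_types, lifting))
  define U where "U = (\<Union>i\<in>C. ball (fst i) (snd i))"
  have [measurable]: "U \<in> sets borel" unfolding U_def by (intro borel_open open_UN) auto
  \<comment> \<open>What the disjoint balls leave over is negligible, and so is its preimage, the
    image of a null set under the linear map \<open>h\<close>.\<close>
  define Z where "Z = box l u - U"
  have [measurable]: "Z \<in> sets borel" unfolding Z_def by auto
  have Z: "emeasure lborel Z = 0" "emeasure lborel (g -` Z) = 0"
  proof -
    have "negligible (g -` Z)" unfolding vim
      using neg orthogonal_transformation_linear[OF h]
      by (intro negligible_differentiable_image_negligible)
         (auto simp: U_def Z_def intro!: linear_imp_differentiable_on)
    then have "emeasure lebesgue (g -` Z) = 0" by (auto simp: negligible_iff_null_sets)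
    moreover have "g -` Z \<in> sets borel" using measurable_sets_borel[of g borel Z] by auto
    ultimately show "emeasure lborel (g -` Z) = 0" by (simp add: main_part_sets)
    have "emeasure lebesgue Z = 0" using neg by (auto simp: negligible_iff_null_sets U_def Z_def)
    then show "emeasure lborel Z = 0" by simp
  qed
  have U: "emeasure lborel (g -` U) = emeasure lborel U"
  proof -
    have "disjoint_family_on (\<lambda>i. ball (fst i) (snd i)) C"
      using dis by (auto simp: disjoint_family_on_def pairwise_def disjnt_def)
    moreover from this have "disjoint_family_on (\<lambda>i. g -` ball (fst i) (snd i)) C"
      unfolding disjoint_family_on_def by (metis vimage_Int vimage_empty)
    moreover have "g -` ball c r \<in> sets borel" for c r
      using measurable_sets_borel[of g borel "ball c r"] by auto
    moreover have "g -` U = (\<Union>i\<in>C. g -` ball (fst i) (snd i))" by (auto simp: U_def)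
    ultimately show ?thesis unfolding U_def using C(1)
      by (simp add: emeasure_UN_countable ball image_subset_iff vimage_UN)
  qed
  have split: "box l u = U \<union> Z" "U \<inter> Z = {}" using C(2) by (auto simp: U_def Z_def)
  have "emeasure (distr lborel borel g) (box l u) = emeasure lborel (g -` U \<union> g -` Z)"
    by (subst emeasure_distr) (auto simp: split)
  also have "\<dots> = emeasure lborel (g -` U) + emeasure lborel (g -` Z)"
    using split(2) measurable_sets_borel[of g borel Z] measurable_sets_borel[of g borel U]
    by (intro plus_emeasure[symmetric]) auto
  also have "\<dots> = emeasure lborel U + emeasure lborel Z" using U Z by simp
  also have "\<dots> = emeasure lborel (box l u)" unfolding split(1) using split(2)
    by (intro plus_emeasure) auto
  finally show "emeasure (distr lborel borel g) (box l u) = (\<Prod>b\<in>Basis. (u - l) \<bullet> b)"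
    using lu by (simp add: emeasure_lborel_box_eq)
qed simp

subsection \<open>The principal value\<close>

lemma integral_lborel_reflect:
  fixes g :: "'a::euclidean_space \<Rightarrow> 'b::{banach, second_countable_topology}"
  assumes [measurable]: "g \<in> borel_measurable borel" 
  shows "(LINT y|lborel. g (c - y)) = (LINT y|lborel. g y)"
proof -
  have "lborel = distr lborel borel (\<lambda>y::'a. c - y)"
    using lborel_affine[of "-1" c] by (simp add: density_1)
  then have "(LINT y|lborel. g y) = (LINT y|distr lborel borel (\<lambda>y. c - y). g y)" by metis
  also have "\<dots> = (LINT y|lborel. g (c - y))" by (rule integral_distr) auto
  finally show ?thesis by simp
qed

text \<open>The reflection in \<open>x\<close> preserves the integral and changes the sign of
  \<open>g\<close>, so the integral equals its own negative. For a non-integrable \<open>g\<close>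
  the default value 0 agrees with this.\<close>

lemma integral_odd_eq_0:
  fixes g :: "'a::euclidean_space \<Rightarrow> 'b::{banach, second_countable_topology}"
  assumes [measurable]: "g \<in> borel_measurable borel" and odd: "\<And>y. g (2 *\<^sub>R x - y) = - g y"
  shows "(LINT y|lebesgue. g y) = 0"
proof -
  have "(LINT y|lborel. g y) = - (LINT y|lborel. g y)"
    using integral_lborel_reflect[of g "2 *\<^sub>R x"] by (simp add: odd)
  then have "2 *\<^sub>R (LINT y|lborel. g y) = 0" by (simp add: scaleR_2 eq_neg_iff_add_eq_0)
  then show ?thesis by (simp add: integral_completion)
qed

lemma integral_lborel_translate:
  fixes g :: "'a::euclidean_space \<Rightarrow> 'b::{banach, second_countable_topology}"
  assumes [measurable]: "g \<in> borel_measurable borel"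
  shows "(LINT y|lborel. g (y - x)) = (LINT y|lborel. g y)"
    and "integrable lborel (\<lambda>y. g (y - x)) = integrable lborel g"
proof -
  have D: "lborel = distr lborel borel (\<lambda>y::'a. y - x)"
    using lborel_affine[of 1 "-x"] by (simp add: density_1)
  have "(LINT y|lborel. g y) = (LINT y|distr lborel borel (\<lambda>y. y - x). g y)" using D by metis
  also have "\<dots> = (LINT y|lborel. g (y - x))" by (rule integral_distr) auto
  finally show "(LINT y|lborel. g (y - x)) = (LINT y|lborel. g y)" by simp
  have "integrable lborel g = integrable (distr lborel borel (\<lambda>y. y - x)) g" using D by metis
  also have "\<dots> = integrable lborel (\<lambda>y. g (y - x))" by (rule integrable_distr_eq) auto
  finally show "integrable lborel (\<lambda>y. g (y - x)) = integrable lborel g" by simp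
qed

text \<open>This lets a linear correction on an annulus be added to an integrand for free. Away from
  \<open>x\<close> the kernel is integrable by \<open>outer_kernel\<close>, and \<open>l\<close> is
  bounded on \<open>ball x r\<close>; oddness about \<open>x\<close> gives the value 0.\<close>

lemma odd_kernel:
  fixes x :: "'a::euclidean_space" and a e r :: real and l :: "'a \<Rightarrow> 'b::{banach, second_countable_topology}"
  assumes l: "bounded_linear l" and "0 < a" "0 < e"
  defines "g \<equiv> (\<lambda>y. (indicator (ball x r - ball x a) y * norm (x - y) powr (- e - real DIM('a))) *\<^sub>R l (y - x))"
  shows "integrable lebesgue g" and "(LINT y|lebesgue. g y) = 0"
proof -
  have [measurable]: "l \<in> borel_measurable borel"
    by (intro borel_measurable_continuous_onI linear_continuous_on l)
  have [measurable]: "ball x r - ball x a \<in> sets borel" by auto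
  have g[measurable]: "g \<in> borel_measurable borel" unfolding g_def by measurable
  obtain B where B: "B > 0" "\<And>v. norm (l v) \<le> norm v * B" using bounded_linear.pos_bounded[OF l] by auto
  obtain C where "\<And>x r. r > 0 \<Longrightarrow> integrable lebesgue (\<lambda>y::'a. indicator (- ball x r) y * norm (x - y) powr (- e - real DIM('a)))"
    using outer_kernel[OF \<open>0 < e\<close>, where 'a='a] by metis
  then have "integrable lebesgue (\<lambda>y. \<bar>r\<bar> * B * (indicator (- ball x a) y * norm (x - y) powr (- e - real DIM('a))))"
    using \<open>0 < a\<close> by simp
  then show "integrable lebesgue g"
  proof (rule Bochner_Integration.integrable_bound)
    show "g \<in> borel_measurable lebesgue" using g by (simp add: measurable_completion)
    have "norm (g y) \<le> \<bar>r\<bar> * B * (indicator (- ball x a) y * norm (x - y) powr (- e - real DIM('a)))" for y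
    proof (cases "y \<in> ball x r - ball x a")
      case True
      then have "norm (l (y - x)) \<le> \<bar>r\<bar> * B"
        using B(1) by (intro order.trans[OF B(2)] mult_right_mono) (auto simp: dist_norm norm_minus_commute)
      then have "norm (x - y) powr (- e - real DIM('a)) * norm (l (y - x)) \<le> norm (x - y) powr (- e - real DIM('a)) * (\<bar>r\<bar> * B)"
        by (intro mult_left_mono) auto
      then show ?thesis using True by (simp add: g_def mult.commute)
    qed (use B in \<open>auto simp: g_def\<close>)
    then show "AE y in lebesgue. norm (g y) \<le> norm (\<bar>r\<bar> * B * (indicator (- ball x a) y * norm (x - y) powr (- e - real DIM('a))))"
      by (intro AE_I2) (smt (verit, ccfv_SIG) real_norm_def)
  qed
  have eq: "2 *\<^sub>R x - y - x = - (y - x)" "x - (2 *\<^sub>R x - y) = - (x - y)" for y by (auto simp: scaleR_2)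
  have "(2 *\<^sub>R x - y \<in> ball x s) = (y \<in> ball x s)" for y s
    unfolding mem_ball dist_norm eq norm_minus_cancel ..
  then have "g (2 *\<^sub>R x - y) = - g y" for y
    unfolding g_def eq norm_minus_cancel linear_neg[OF bounded_linear.linear[OF l]]
    by (simp only: indicator_def Diff_iff scaleR_minus_right)
  then show "(LINT y|lebesgue. g y) = 0" by (intro integral_odd_eq_0[of _ x]) auto
qed

text \<open>
  Cutting off a linear correction \<open>l\<close>, which is odd around \<open>x\<close>, makes the integrand absolutely
  integrable without changing the truncated integrals.
\<close>

lemma pv_eq_integral:
  fixes u :: "real ^ 'n \<Rightarrow> 'b::{banach, second_countable_topology}"
  assumes \<sigma>: "0 < \<sigma>" "\<sigma> < 1"
    and u[measurable]: "u \<in> borel_measurable lebesgue" and M: "AE y in lebesgue. norm (u y) \<le> M"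
    and l: "bounded_linear l" and "r > 0"
    and K: "\<And>y. y \<in> ball x r \<Longrightarrow> norm (u x - u y + l (y - x)) \<le> K * (norm (x - y))\<^sup>2"
  defines "F \<equiv> (\<lambda>y. (u x - u y + indicator (ball x r) y *\<^sub>R l (y - x)) /\<^sub>R (norm (x - y) powr (real CARD('n) + 2 * \<sigma>)))"
  shows "integrable lebesgue F" and "frac_laplacian_pv \<sigma> u x = integral\<^sup>L lebesgue F"
proof -
  define q where "q = real CARD('n) + 2 * \<sigma>"
  have [measurable]: "l \<in> borel_measurable borel"
    by (intro borel_measurable_continuous_onI linear_continuous_on l)
  have meas: "(\<lambda>y. l (y - x)) \<in> borel_measurable lebesgue" "(\<lambda>y. inverse (norm (x - y) powr c)) \<in> borel_measurable lebesgue" for c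
    by (auto intro!: measurable_completion)
  have Fm[measurable]: "F \<in> borel_measurable lebesgue"
    unfolding F_def by (intro borel_measurable_scaleR borel_measurable_diff borel_measurable_add borel_measurable_const
        borel_measurable_indicator meas u) auto
  have e1: "2 - 2 * \<sigma> > 0" and e2: "2 * \<sigma> > 0" using \<sigma> by auto
  from ball_kernel[OF e1, where 'a="real^'n"] obtain C1 where C1: "\<forall>x::real^'n. \<forall>r>0. integrable lebesgue (\<lambda>y. indicator (ball x r) y * norm (x - y) powr ((2 - 2 * \<sigma>) - real DIM(real^'n))) \<and>
      (LINT y|lebesgue. indicator (ball x r) y * norm (x - y) powr ((2 - 2 * \<sigma>) - real DIM(real^'n))) \<le> C1 * r powr (2 - 2 * \<sigma>)"
    by (elim exE conjE)
  from outer_kernel[OF e2, where 'a="real^'n"] obtain C2 where C2: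
    "\<forall>x::real^'n. \<forall>r>0. integrable lebesgue (\<lambda>y. indicator (- ball x r) y * norm (x - y) powr (- (2 * \<sigma>) - real DIM(real^'n))) \<and>
      (LINT y|lebesgue. indicator (- ball x r) y * norm (x - y) powr (- (2 * \<sigma>) - real DIM(real^'n))) \<le> C2 * r powr (- (2 * \<sigma>))"
    by (elim exE conjE)
  have nF: "norm (F y) = norm (u x - u y + indicator (ball x r) y *\<^sub>R l (y - x)) / norm (x - y) powr q" for y
    by (simp add: F_def q_def divide_inverse mult.commute)
  \<comment> \<open>The quadratic bound leaves a singularity of order
    \<open>N - 2 + 2 * \<sigma>\<close> in dimension \<open>N\<close>, which is integrable because
    \<open>\<sigma> < 1\<close>.\<close>
  have Kball: "norm (F y) \<le> K * norm (x - y) powr ((2 - 2 * \<sigma>) - real DIM(real^'n))" if "y \<in> ball x r" for y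
  proof (cases "y = x")
    case True
    then show ?thesis using linear_0[OF bounded_linear.linear[OF l]] by (simp add: F_def)
  next
    case False
    then have "norm (x - y) > 0" by simp
    then have "(norm (x - y))\<^sup>2 / norm (x - y) powr q = norm (x - y) powr ((2 - 2 * \<sigma>) - real DIM(real^'n))"
      by (simp add: q_def flip: powr_numeral powr_diff) (simp add: algebra_simps)
    moreover have "norm (F y) \<le> K * (norm (x - y))\<^sup>2 / norm (x - y) powr q"
      using K[OF that] that unfolding nF by (intro divide_right_mono) auto
    ultimately show ?thesis by (simp flip: times_divide_eq_right)
  qed
  define w where "w = (\<lambda>y. K * (indicator (ball x r) y * norm (x - y) powr ((2 - 2 * \<sigma>) - real DIM(real^'n)))
      + (norm (u x) + M) * (indicator (- ball x r) y * norm (x - y) powr (- (2 * \<sigma>) - real DIM(real^'n))))"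
  have w: "integrable lebesgue w" unfolding w_def using C1 C2 \<open>r > 0\<close> by auto
  have Fw: "AE y in lebesgue. norm (F y) \<le> w y"
    using M
  proof eventually_elim
    case (elim y)
    show ?case
    proof (cases "y \<in> ball x r")
      case True then show ?thesis using Kball[OF True] by (simp add: w_def)
    next
      case False
      have "norm (u x - u y) \<le> norm (u x) + M" using elim norm_triangle_ineq4[of "u x" "u y"] by linarith
      then have "norm (u x - u y) * norm (x - y) powr (- q) \<le> (norm (u x) + M) * norm (x - y) powr (-q)"
        by (intro mult_right_mono) auto
      moreover have "norm (F y) = norm (u x - u y) * norm (x - y) powr (- q)"
        using False by (simp add: nF powr_minus divide_inverse)
      moreover have "w y = (norm (u x) + M) * norm (x - y) powr (- q)"
      proof -
        have eqq: "- (2 * \<sigma>) - real DIM(real^'n) = - q" by (simp add: q_def)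
        show ?thesis using False unfolding w_def eqq by simp
      qed
      ultimately show ?thesis by simp
    qed
  qed
  show int: "integrable lebesgue F"
    by (rule Bochner_Integration.integrable_bound[OF w Fm]) (use Fw in eventually_elim, simp)
  define I where "I = (\<lambda>\<epsilon>. LINT y : - ball x \<epsilon> | lebesgue. (u x - u y) /\<^sub>R (norm (x - y) powr (real CARD('n) + 2 * \<sigma>)))"
  have I: "norm (integral\<^sup>L lebesgue F - I \<epsilon>) \<le> \<bar>K\<bar> * (C1 * \<epsilon> powr (2 - 2 * \<sigma>))" if \<epsilon>: "0 < \<epsilon>" "\<epsilon> < r" for \<epsilon>
  proof -
    define g where "g = (\<lambda>y. (indicator (ball x r - ball x \<epsilon>) y * norm (x - y) powr (- (2*\<sigma>) - real DIM(real^'n))) *\<^sub>R l (y - x))"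
    have g: "integrable lebesgue g" "integral\<^sup>L lebesgue g = 0"
      unfolding g_def using odd_kernel[OF l \<epsilon>(1)] \<sigma> by auto
    have i1: "integrable lebesgue (\<lambda>y. indicator (ball x \<epsilon>) y *\<^sub>R F y)"
    proof (rule Bochner_Integration.integrable_bound[OF int])
      show "(\<lambda>y. indicator (ball x \<epsilon>) y *\<^sub>R F y) \<in> borel_measurable lebesgue"
        by (intro borel_measurable_scaleR borel_measurable_indicator Fm) auto
    qed (auto simp: indicator_def)
    \<comment> \<open>Outside \<open>ball x \<epsilon>\<close> the function \<open>F\<close> and the
      truncated integrand differ only by \<open>g\<close>, whose integral is 0. The truncation error
      is thus the integral of \<open>F\<close> over the small ball.\<close>
    have "I \<epsilon> = (LINT y|lebesgue. F y - indicator (ball x \<epsilon>) y *\<^sub>R F y - g y)"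
      unfolding I_def set_lebesgue_integral_def
    proof (rule arg_cong[where f="integral\<^sup>L lebesgue"], rule ext)
      fix y
      show "indicator (- ball x \<epsilon>) y *\<^sub>R ((u x - u y) /\<^sub>R norm (x - y) powr (real CARD('n) + 2 * \<sigma>)) = F y - indicator (ball x \<epsilon>) y *\<^sub>R F y - g y"
        using \<epsilon>
        by (auto simp: minus_diff_commute[of "2 * \<sigma>" "real CARD('n)"] F_def g_def indicator_def scaleR_add_right powr_minus simp flip: powr_minus)
    qed
    also have "\<dots> = integral\<^sup>L lebesgue F - (LINT y|lebesgue. indicator (ball x \<epsilon>) y *\<^sub>R F y)"
      using int i1 g by simp
    finally have "integral\<^sup>L lebesgue F - I \<epsilon> = (LINT y|lebesgue. indicator (ball x \<epsilon>) y *\<^sub>R F y)" by simp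
    also have "norm \<dots> \<le> (LINT y|lebesgue. \<bar>K\<bar> * (indicator (ball x \<epsilon>) y * norm (x - y) powr ((2 - 2 * \<sigma>) - real DIM(real^'n))))"
    proof (rule Bochner_Integration.integral_norm_bound_integral[OF i1])
      show "integrable lebesgue (\<lambda>y. \<bar>K\<bar> * (indicator (ball x \<epsilon>) y * norm (x - y) powr ((2 - 2 * \<sigma>) - real DIM(real^'n))))"
        using C1 \<epsilon> by auto
      fix y
      have "K * norm (x - y) powr ((2 - 2 * \<sigma>) - real DIM(real^'n)) \<le> \<bar>K\<bar> * norm (x - y) powr ((2 - 2 * \<sigma>) - real DIM(real^'n))"
        by (intro mult_right_mono) auto
      then show "norm (indicator (ball x \<epsilon>) y *\<^sub>R F y) \<le> \<bar>K\<bar> * (indicator (ball x \<epsilon>) y * norm (x - y) powr ((2 - 2 * \<sigma>) - real DIM(real^'n)))"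
        using Kball[of y] \<epsilon> by (auto simp: indicator_def)
    qed
    also have "\<dots> \<le> \<bar>K\<bar> * (C1 * \<epsilon> powr (2 - 2 * \<sigma>))"
      using C1[rule_format, OF \<epsilon>(1), of x] by (auto intro!: mult_left_mono)
    finally show ?thesis .
  qed
  have "((\<lambda>\<epsilon>. integral\<^sup>L lebesgue F - I \<epsilon>) \<longlongrightarrow> 0) (at_right 0)"
  proof (rule Lim_null_comparison)
    show "\<forall>\<^sub>F \<epsilon> in at_right 0. norm (integral\<^sup>L lebesgue F - I \<epsilon>) \<le> \<bar>K\<bar> * (C1 * \<epsilon> powr (2 - 2 * \<sigma>))"
      unfolding eventually_at_right_field using I \<open>r > 0\<close> by auto
    have "((\<lambda>\<epsilon>. \<epsilon> powr (2 - 2 * \<sigma>)) \<longlongrightarrow> 0 powr (2 - 2 * \<sigma>)) (at_right (0::real))"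
      using \<sigma> by (intro tendsto_powr' tendsto_ident_at tendsto_const) (auto simp: eventually_at_right_field intro: exI[of _ 1])
    then show "((\<lambda>\<epsilon>. \<bar>K\<bar> * (C1 * \<epsilon> powr (2 - 2 * \<sigma>))) \<longlongrightarrow> 0) (at_right 0)"
      by (auto intro!: tendsto_mult_right_zero)
  qed
  then have "((\<lambda>\<epsilon>. integral\<^sup>L lebesgue F - (integral\<^sup>L lebesgue F - I \<epsilon>)) \<longlongrightarrow> integral\<^sup>L lebesgue F - 0) (at_right 0)"
    by (intro tendsto_diff tendsto_const)
  then have "(I \<longlongrightarrow> integral\<^sup>L lebesgue F) (at_right 0)" by simp
  then show "frac_laplacian_pv \<sigma> u x = integral\<^sup>L lebesgue F"
    unfolding frac_laplacian_pv_def I_def by (intro tendsto_Lim) auto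
qed

subsection \<open>The normalizing constant\<close>

text \<open>Up to sign this is the first-order Taylor remainder of \<open>cis\<close> at 0; its real
  and imaginary parts are each at most \<open>t\<^sup>2\<close> in absolute value.\<close>

lemma norm_cis_quadratic: "norm (1 - cis t + \<i> * of_real t) \<le> 2 * t\<^sup>2"
proof -
  have "\<bar>1 - cos t\<bar> \<le> t\<^sup>2"
  proof -
    have "1 - cos t = 2 * (sin (t / 2))\<^sup>2" using cos_double_sin[of "t / 2"] by simp
    also have "\<dots> \<le> 2 * (t / 2)\<^sup>2"
      by (intro mult_left_mono iffD1[OF abs_le_square_iff] abs_sin_x_le_abs_x) simp
    finally have "1 - cos t \<le> t\<^sup>2 / 2" by (simp add: power_divide)
    then show ?thesis using zero_le_power2[of t] cos_le_one[of t] by linarith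
  qed
  moreover have "\<bar>t - sin t\<bar> \<le> t\<^sup>2"
  proof -
    have "\<bar>sin t - t\<bar> \<le> t\<^sup>2 / 2"
      using Maclaurin_sin_bound[of t 2] by (simp add: numeral_2_eq_2 sin_coeff_def)
    then show ?thesis using zero_le_power2[of t] by linarith
  qed
  ultimately show ?thesis
    using cmod_le[of "1 - cis t + \<i> * of_real t"] by simp
qed

text \<open>For \<open>q = N + 2 * \<sigma>\<close> in dimension \<open>N\<close> this is the
  Fourier symbol before normalization.\<close>

definition cos_transform :: "real \<Rightarrow> 'a::euclidean_space \<Rightarrow> real" where
  "cos_transform q \<xi> = (LINT z|lborel. (1 - cos (\<xi> \<bullet> z)) * norm z powr (- q))"

text \<open>The phase at \<open>x\<close> factors out of the principal value. In what remains, the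
  imaginary part is odd about \<open>x\<close> and integrates to 0, and the real part is the cosine
  transform after a translation.\<close>

lemma pv_plane_wave:
  fixes \<xi> x :: "real ^ 'n"
  assumes \<sigma>: "0 < \<sigma>" "\<sigma> < 1"
  defines "q \<equiv> real CARD('n) + 2 * \<sigma>"
  shows "integrable lborel (\<lambda>z. (1 - cos (\<xi> \<bullet> z)) * norm z powr (- q))"
    and "frac_laplacian_pv \<sigma> (\<lambda>y. cis (\<xi> \<bullet> y)) x = cos_transform q \<xi> *\<^sub>R cis (\<xi> \<bullet> x)"
proof -
  define u where "u = (\<lambda>y::real^'n. cis (\<xi> \<bullet> y))"
  \<comment> \<open>\<open>l\<close> is the derivative of \<open>u\<close> at \<open>x\<close>, so
    \<open>u x - u y + l (y - x)\<close> is a Taylor remainder of second order.\<close>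
  define l where "l = (\<lambda>v::real^'n. cis (\<xi> \<bullet> x) * (\<i> * of_real (\<xi> \<bullet> v)))"
  define F where "F = (\<lambda>y. (u x - u y + indicator (ball x 1) y *\<^sub>R l (y - x)) /\<^sub>R (norm (x - y) powr (real CARD('n) + 2 * \<sigma>)))"
  have l: "bounded_linear l"
    unfolding l_def
    by (intro bounded_linear_mult_const bounded_linear_const_mult bounded_linear_compose[OF bounded_linear_of_real] bounded_linear_inner_right)
  have split: "u x - u y + k *\<^sub>R l (y - x) = cis (\<xi> \<bullet> x) * (1 - cis (\<xi> \<bullet> (y - x)) + \<i> * of_real (k * (\<xi> \<bullet> (y - x))))" for y k
    by (simp add: u_def l_def inner_diff_right cis_mult algebra_simps scaleR_conv_of_real)
  have uc: "continuous_on UNIV u" unfolding u_def by (intro continuous_intros)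
  then have um[measurable]: "u \<in> borel_measurable borel" by (rule borel_measurable_continuous_onI)
  have bd: "norm (u x - u y + l (y - x)) \<le> (2 * (norm \<xi>)\<^sup>2) * (norm (x - y))\<^sup>2" for y
  proof -
    have "norm (u x - u y + l (y - x)) \<le> 2 * (\<xi> \<bullet> (y - x))\<^sup>2"
      using split[of y 1] norm_cis_quadratic[of "\<xi> \<bullet> (y - x)"] by (simp add: norm_mult)
    also have "\<dots> \<le> 2 * (norm \<xi> * norm (x - y))\<^sup>2"
      using Cauchy_Schwarz_ineq2[of \<xi> "y - x"] abs_le_square_iff[of "\<xi> \<bullet> (y - x)" "norm \<xi> * norm (x - y)"]
      by (simp add: norm_minus_commute)
    finally show ?thesis by (simp add: power_mult_distrib)
  qed
  have "u \<in> borel_measurable lebesgue" by (simp add: measurable_completion)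
  moreover have "AE y in lebesgue. norm (u y) \<le> 1" by (simp add: u_def)
  ultimately have F: "integrable lebesgue F" "frac_laplacian_pv \<sigma> u x = integral\<^sup>L lebesgue F"
    using pv_eq_integral[OF \<sigma> _ _ l zero_less_one bd] unfolding F_def by auto
  define G where "G = (\<lambda>y. F y * cis (- (\<xi> \<bullet> x)))"
  have GF: "F y = G y * cis (\<xi> \<bullet> x)" for y by (simp add: G_def mult.assoc cis_mult)
  have G: "integrable lebesgue G" unfolding G_def using F(1) by simp
  have Geq: "G y = (1 - cis (\<xi> \<bullet> (y - x)) + \<i> * of_real (indicator (ball x 1) y * (\<xi> \<bullet> (y - x)))) * of_real (norm (x - y) powr (- q))" for y
  proof -
    have "F y = cis (\<xi> \<bullet> x) * ((1 - cis (\<xi> \<bullet> (y - x)) + \<i> * of_real (indicator (ball x 1) y * (\<xi> \<bullet> (y - x)))) * of_real (norm (x - y) powr (- q)))"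
    proof -
      have "inverse (norm (x - y) powr (real CARD('n) + 2 * \<sigma>)) = norm (x - y) powr (- q)"
        unfolding q_def by (rule powr_minus[symmetric])
      then show ?thesis unfolding F_def split by (simp only: scaleR_conv_of_real mult_ac)
    qed
    moreover have "cis (\<xi> \<bullet> x) * X * cis (- (\<xi> \<bullet> x)) = X" for X
    proof -
      have "cis (\<xi> \<bullet> x) * X * cis (- (\<xi> \<bullet> x)) = X * (cis (\<xi> \<bullet> x) * cis (- (\<xi> \<bullet> x)))" by (simp only: mult_ac)
      then show ?thesis by (simp add: cis_mult)
    qed
    ultimately show ?thesis by (simp only: G_def)
  qed
  define h where "h = (\<lambda>z::real^'n. (1 - cos (\<xi> \<bullet> z)) * norm z powr (- q))"
  have hm[measurable]: "h \<in> borel_measurable borel" unfolding h_def by measurable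
  have ReG: "Re (G y) = h (y - x)" for y
    by (simp add: Geq h_def norm_minus_commute)
  have ImG: "Im (G y) = (- sin (\<xi> \<bullet> (y - x)) + indicator (ball x 1) y * (\<xi> \<bullet> (y - x))) * norm (x - y) powr (- q)" for y
    by (simp add: Geq)
  have [measurable]: "ball x 1 \<in> sets borel" by auto
  have "(LINT y|lebesgue. Im (G y)) = 0"
  proof (rule integral_odd_eq_0)
    show "(\<lambda>y. Im (G y)) \<in> borel_measurable borel" unfolding ImG by measurable
    fix y
    have eq: "2 *\<^sub>R x - y - x = - (y - x)" "x - (2 *\<^sub>R x - y) = - (x - y)" by (auto simp: scaleR_2)
    have "(2 *\<^sub>R x - y \<in> ball x 1) = (y \<in> ball x 1)"
      unfolding mem_ball dist_norm eq norm_minus_cancel ..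
    then have "indicator (ball x 1) (2 *\<^sub>R x - y) = (indicator (ball x 1) y :: real)" by (simp only: indicator_def)
    moreover have "(- (- s) + i * - t) * k = - ((- s + i * t) * k)" for s i t k :: real
      by (simp add: algebra_simps)
    ultimately show "Im (G (2 *\<^sub>R x - y)) = - Im (G y)"
      by (simp only: ImG eq norm_minus_cancel inner_minus_right sin_minus)
  qed
  moreover have "integrable lebesgue (\<lambda>y. h (y - x))" using integrable_Re[OF G] by (simp add: ReG)
  then have hi: "integrable lborel (\<lambda>y. h (y - x))" by (subst (asm) integrable_completion) auto
  moreover have "(LINT y|lebesgue. Re (G y)) = (LINT y|lborel. h y)"
    unfolding ReG by (subst integral_completion) (auto simp: integral_lborel_translate)
  ultimately have "integral\<^sup>L lebesgue G = of_real (LINT y|lborel. h y)"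
    using G by (simp add: complex_eq_iff)
  then have "integral\<^sup>L lebesgue F = of_real (LINT y|lborel. h y) * cis (\<xi> \<bullet> x)"
    unfolding GF using G by simp
  then show "frac_laplacian_pv \<sigma> (\<lambda>y. cis (\<xi> \<bullet> y)) x = cos_transform q \<xi> *\<^sub>R cis (\<xi> \<bullet> x)"
    using F(2) by (simp add: u_def cos_transform_def h_def scaleR_conv_of_real)
  show "integrable lborel (\<lambda>z. (1 - cos (\<xi> \<bullet> z)) * norm z powr (- q))"
    using hi integral_lborel_translate(2)[OF hm] by (simp add: h_def)
qed

text \<open>Rotations preserve inner products and norms, and dilations turn the kernel into a
  multiple of itself, so one unit vector determines the transform. For \<open>\<xi> = 0\<close> both
  sides are 0, since \<open>0 powr _\<close> is 0.\<close>

lemma cos_transform_eq: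
  fixes \<xi> e :: "real ^ 'n"
  assumes "norm e = 1"
  shows "cos_transform q \<xi> = norm \<xi> powr (q - real CARD('n)) * cos_transform q e"
proof (cases "\<xi> = 0")
  case True
  then show ?thesis by (simp add: cos_transform_def)
next
  case False
  define a where "a = norm \<xi>"
  have a: "a > 0" using False by (simp add: a_def)
  obtain g where g: "orthogonal_transformation g" "g e = \<xi> /\<^sub>R a"
    using orthogonal_transformation_exists_1[of e "\<xi> /\<^sub>R a"] assms a by (auto simp: a_def)
  have lin: "linear g" using g by (simp add: orthogonal_transformation_linear)
  have [measurable]: "g \<in> borel_measurable borel"
    using lin by (intro borel_measurable_continuous_onI linear_continuous_on) (simp add: linear_conv_bounded_linear)
  define h where "h = (\<lambda>\<xi> z::real^'n. (1 - cos (\<xi> \<bullet> z)) * norm z powr (- q))"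
  have hm[measurable]: "h \<xi> \<in> borel_measurable borel" for \<xi> unfolding h_def by measurable
  \<comment> \<open>The dilation \<open>z / a\<close> has Jacobian \<open>(1/a)^N\<close> and the
    kernel contributes \<open>a powr q\<close>; the rotation \<open>g\<close> then moves the
    direction of the frequency to \<open>e\<close>.\<close>
  have "(LINT z|lborel. h \<xi> z) = (LINT z|density (distr lborel borel (\<lambda>z. 0 + (1/a) *\<^sub>R z)) (\<lambda>_. \<bar>1/a\<bar>^DIM(real^'n)). h \<xi> z)"
    using lborel_affine[of "1/a" "0::real^'n"] a by simp
  also have "\<dots> = (LINT z|lborel. (1/a)^CARD('n) * h \<xi> ((1/a) *\<^sub>R z))"
    using a by (subst integral_density) (auto simp: integral_distr)
  also have "\<dots> = (LINT z|distr lborel borel g. (1/a)^CARD('n) * h \<xi> ((1/a) *\<^sub>R z))"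
    by (simp add: distr_lborel_orthogonal[OF g(1)])
  also have "\<dots> = (LINT z|lborel. (1/a)^CARD('n) * h \<xi> ((1/a) *\<^sub>R g z))"
    by (rule integral_distr) auto
  also have "\<dots> = (LINT z|lborel. a powr (q - real CARD('n)) * h e z)"
  proof (rule Bochner_Integration.integral_cong)
    fix z
    have "\<xi> \<bullet> ((1/a) *\<^sub>R g z) = g e \<bullet> g z" using a by (simp add: g(2) divide_inverse)
    also have "\<dots> = e \<bullet> z" using g(1) by (simp add: orthogonal_transformation_def)
    finally have 1: "\<xi> \<bullet> ((1/a) *\<^sub>R g z) = e \<bullet> z" .
    have 2: "norm ((1/a) *\<^sub>R g z) powr (- q) = a powr q * norm z powr (- q)"
    proof -
      have "norm ((1/a) *\<^sub>R g z) = norm z / a"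
        using a by (simp add: orthogonal_transformation_norm[OF g(1)])
      then show ?thesis using a by (simp add: powr_divide powr_minus field_simps)
    qed
    have 3: "a powr (q - real CARD('n)) = (1/a)^CARD('n) * a powr q"
      using a by (simp add: powr_diff powr_realpow power_one_over field_simps)
    show "(1/a)^CARD('n) * h \<xi> ((1/a) *\<^sub>R g z) = a powr (q - real CARD('n)) * h e z"
      unfolding h_def 1 2 3 by (simp add: mult_ac)
  qed simp
  finally show ?thesis by (simp add: cos_transform_def h_def a_def)
qed

text \<open>The definite description can be evaluated once exactly one constant qualifies. Existence
  needs a positive cosine transform at a unit vector, whose reciprocal is the constant; testing with
  that frequency at the origin shows uniqueness.\<close>

lemma frac_laplacian_const_pos:
  assumes \<sigma>: "0 < \<sigma>" "\<sigma> < 1"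
  shows "frac_laplacian_const TYPE('n::finite) \<sigma> > 0"
proof -
  define q where "q = real CARD('n) + 2 * \<sigma>"
  define e where "e = (axis undefined 1 :: real ^ 'n)"
  have e: "norm e = 1" by (simp add: e_def norm_axis_1)
  define h where "h = (\<lambda>z. (1 - cos (e \<bullet> z)) * norm z powr (- q))"
  have hi: "integrable lborel h" unfolding h_def q_def by (rule pv_plane_wave[OF \<sigma>])
  \<comment> \<open>Otherwise the nonnegative integrand would vanish almost everywhere. On
    \<open>ball e (1/2)\<close> it is positive, as \<open>e \<bullet> z\<close> lies strictly
    between 0 and 2, hence below \<open>pi\<close>.\<close>
  have T: "cos_transform q e > 0"
  proof (rule ccontr)
    assume "\<not> 0 < cos_transform q e"
    moreover have "cos_transform q e = (LINT z|lborel. h z)" by (simp add: cos_transform_def h_def)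
    moreover have h0: "h z \<ge> 0" for z by (simp add: h_def)
    ultimately have "(LINT z|lborel. h z) = 0"
      using Bochner_Integration.integral_nonneg[of lborel h] by (simp add: antisym not_less)
    then have "AE z in lborel. h z = 0"
      using integral_nonneg_eq_0_iff_AE[OF hi] h0 by simp
    then have "AE z in lborel. z \<notin> ball e (1/2)"
    proof eventually_elim
      case (elim z)
      show ?case
      proof
        assume z: "z \<in> ball e (1/2)"
        have "\<bar>e \<bullet> (z - e)\<bar> \<le> norm (z - e)" using Cauchy_Schwarz_ineq2[of e "z - e"] e by simp
        also have "\<dots> < 1/2" using z by (simp add: dist_norm norm_minus_commute)
        finally have "\<bar>e \<bullet> z - 1\<bar> < 1/2" using e by (simp add: inner_diff_right norm_eq_1)
        then have "0 < e \<bullet> z" "e \<bullet> z < 2" by linarith+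
        then have "cos (e \<bullet> z) < 1" "z \<noteq> 0"
          using cos_monotone_0_pi[of 0 "e \<bullet> z"] pi_gt3 by auto
        then show False using elim by (auto simp: h_def)
      qed
    qed
    then have "emeasure lborel (ball e (1/2)) = 0"
      by (subst (asm) AE_iff_measurable[of "ball e (1/2)"]) auto
    then show False using content_ball_gt_0_iff[of e "1/2"] by (simp add: measure_def)
  qed
  let ?P = "\<lambda>c. c > 0 \<and> (\<forall>\<xi> x :: real ^ 'n. c *\<^sub>R frac_laplacian_pv \<sigma> (\<lambda>y. cis (\<xi> \<bullet> y)) x =
        (norm \<xi> powr (2 * \<sigma>)) *\<^sub>R cis (\<xi> \<bullet> x))"
  have pv: "frac_laplacian_pv \<sigma> (\<lambda>y. cis (\<xi> \<bullet> y)) x = (norm \<xi> powr (2 * \<sigma>) * cos_transform q e) *\<^sub>R cis (\<xi> \<bullet> x)"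
    for \<xi> x :: "real ^ 'n"
    using pv_plane_wave(2)[OF \<sigma>, of \<xi> x] cos_transform_eq[OF e, of q \<xi>] by (simp add: q_def)
  have "?P (1 / cos_transform q e)"
    using T by (simp add: pv)
  moreover have "c = 1 / cos_transform q e" if "?P c" for c
  proof -
    have "c *\<^sub>R frac_laplacian_pv \<sigma> (\<lambda>y. cis (e \<bullet> y)) 0 = (norm e powr (2 * \<sigma>)) *\<^sub>R cis (e \<bullet> 0)"
      using that by blast
    then have "(c * cos_transform q e) *\<^sub>R (1::complex) = 1 *\<^sub>R 1" unfolding pv by (simp add: e)
    then have "c * cos_transform q e = 1" by (simp only: scaleR_cancel_right) simp
    then show ?thesis using T by (simp add: field_simps)
  qed
  ultimately have "?P (THE c. ?P c)" by (rule theI)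
  then show ?thesis unfolding frac_laplacian_const_def by blast
qed

subsection \<open>Upper bound for the principal value\<close>

text \<open>There are three zones: the two-sided bound tames the singularity within
  \<open>r\<close>, a one-sided bound suffices between \<open>r\<close> and \<open>s\<close>, and
  beyond \<open>s\<close> only boundedness is used. \<open>C\<close> depends only on the dimension
  and \<open>\<sigma>\<close>. As \<open>K\<close> comes with its own radius, a small
  \<open>r\<close> can absorb a large \<open>K\<close>.\<close>

lemma pv_upper_bound:
  assumes \<sigma>: "0 < \<sigma>" "\<sigma> < 1"
  shows "\<exists>C\<ge>0. \<forall>(u :: real ^ 'n \<Rightarrow> real) x l m K B \<delta> M r s.
    u \<in> borel_measurable lebesgue \<longrightarrow> (AE y in lebesgue. \<bar>u y\<bar> \<le> M) \<longrightarrow> \<bar>u x\<bar> \<le> M \<longrightarrow>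
    bounded_linear l \<longrightarrow> bounded_linear m \<longrightarrow> 0 < r \<longrightarrow> r \<le> s \<longrightarrow> 0 \<le> K \<longrightarrow> 0 \<le> B \<longrightarrow> 0 \<le> \<delta> \<longrightarrow>
    (\<forall>y\<in>ball x r. \<bar>u x - u y + l (y - x)\<bar> \<le> K * (norm (x - y))\<^sup>2) \<longrightarrow>
    (\<forall>y\<in>ball x s. u x - u y \<le> m (y - x) + B * (norm (x - y))\<^sup>2 + \<delta>) \<longrightarrow>
    frac_laplacian_pv \<sigma> u x \<le>
      C * (K * r powr (2 - 2 * \<sigma>) + \<delta> * r powr (- (2 * \<sigma>)) + B * s powr (2 - 2 * \<sigma>) + M * s powr (- (2 * \<sigma>)))"
proof -
  have e1: "2 - 2 * \<sigma> > 0" and e2: "2 * \<sigma> > 0" using \<sigma> by auto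
  define k where "k = (\<lambda>(x::real^'n) y. norm (x - y) powr ((2 - 2 * \<sigma>) - real DIM(real^'n)))"
  define k0 where "k0 = (\<lambda>(x::real^'n) y. norm (x - y) powr (- (2 * \<sigma>) - real DIM(real^'n)))"
  from ball_kernel[OF e1, where 'a="real^'n"] obtain C1 where C1_nonneg: "C1 \<ge> 0"
    and C1: "\<forall>x::real^'n. \<forall>r>0. integrable lebesgue (\<lambda>y. indicator (ball x r) y * k x y) \<and>
      (LINT y|lebesgue. indicator (ball x r) y * k x y) \<le> C1 * r powr (2 - 2 * \<sigma>)"
    unfolding k_def by (elim exE conjE)
  from outer_kernel[OF e2, where 'a="real^'n"] obtain C2 where C2_nonneg: "C2 \<ge> 0" and C2:
    "\<forall>x::real^'n. \<forall>r>0. integrable lebesgue (\<lambda>y. indicator (- ball x r) y * k0 x y) \<and>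
      (LINT y|lebesgue. indicator (- ball x r) y * k0 x y) \<le> C2 * r powr (- (2 * \<sigma>))"
    unfolding k0_def by (elim exE conjE)
  show ?thesis
  proof (intro exI[of _ "C1 + 2 * C2"] conjI allI impI)
    show "0 \<le> C1 + 2 * C2" using C1_nonneg C2_nonneg by simp
    fix u :: "real ^ 'n \<Rightarrow> real" and x l m and K B \<delta> M r s :: real
    assume u: "u \<in> borel_measurable lebesgue" "AE y in lebesgue. \<bar>u y\<bar> \<le> M" and ux: "\<bar>u x\<bar> \<le> M"
      and l: "bounded_linear l" and m: "bounded_linear m" and rs: "0 < r" "r \<le> s"
      and nn: "0 \<le> K" "0 \<le> B" "0 \<le> \<delta>"
      and near: "\<forall>y\<in>ball x r. \<bar>u x - u y + l (y - x)\<bar> \<le> K * (norm (x - y))\<^sup>2"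
      and mid: "\<forall>y\<in>ball x s. u x - u y \<le> m (y - x) + B * (norm (x - y))\<^sup>2 + \<delta>"
    have M: "0 \<le> M" using ux by linarith
    have s: "0 < s" using rs by simp
    define q where "q = real CARD('n) + 2 * \<sigma>"
    define F where "F = (\<lambda>y. (u x - u y + indicator (ball x r) y *\<^sub>R l (y - x)) /\<^sub>R (norm (x - y) powr (real CARD('n) + 2 * \<sigma>)))"
    have F: "integrable lebesgue F" "frac_laplacian_pv \<sigma> u x = integral\<^sup>L lebesgue F"
      using pv_eq_integral[OF \<sigma> u(1) _ l rs(1), of M x K] u(2) near unfolding F_def by auto
    \<comment> \<open>\<open>m\<close> is cut off near \<open>x\<close>, so that its contribution is integrable and odd, hence zero.\<close>
    define g where "g = (\<lambda>y. (indicator (ball x s - ball x r) y * k0 x y) *\<^sub>R m (y - x))"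
    have g: "integrable lebesgue g" "integral\<^sup>L lebesgue g = 0"
      unfolding g_def k0_def using odd_kernel[OF m rs(1) e2] by auto
    \<comment> \<open>All terms except \<open>g\<close> are nonnegative, so they may overlap beyond
      the zones in which they are needed.\<close>
    define G where "G = (\<lambda>y. K * (indicator (ball x r) y * k x y) + \<delta> * (indicator (- ball x r) y * k0 x y)
        + B * (indicator (ball x s) y * k x y) + 2 * M * (indicator (- ball x s) y * k0 x y) + g y)"
    have kk: "k0 x y = inverse (norm (x - y) powr (real CARD('n) + 2 * \<sigma>))" for y
    proof -
      have "- (2 * \<sigma>) - real DIM(real^'n) = - (real CARD('n) + 2 * \<sigma>)" by simp
      then show ?thesis unfolding k0_def by (simp only: powr_minus)
    qed
    have k2: "(norm (x - y))\<^sup>2 * k0 x y = k x y" if "y \<noteq> x" for y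
    proof -
      have "norm (x - y) > 0" using that by simp
      then show ?thesis
        by (simp add: k_def k0_def flip: powr_numeral powr_add) (simp add: algebra_simps)
    qed
    have pos: "k x y \<ge> 0" "k0 x y \<ge> 0" for y by (simp_all add: k_def k0_def)
    have FG: "AE y in lebesgue. F y \<le> G y"
      using u(2)
    proof eventually_elim
      case (elim y)
      have F_eq: "F y = (u x - u y + indicator (ball x r) y * l (y - x)) * k0 x y"
        by (simp add: F_def kk)
      consider "y = x" | "y \<noteq> x" "y \<in> ball x r" | "y \<notin> ball x r" "y \<in> ball x s" | "y \<notin> ball x r" "y \<notin> ball x s"
        by blast
      then show ?case
      proof cases
        case 1
        then have "F y = 0" using linear_0[OF bounded_linear.linear[OF l]] by (simp add: F_def)
        moreover have "G y \<ge> 0" using 1 rs nn pos by (simp add: G_def g_def)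
        ultimately show ?thesis by simp
      next
        case 2
        have "F y = (u x - u y + l (y - x)) * k0 x y" using 2 by (simp add: F_eq)
        also have "\<dots> \<le> (K * (norm (x - y))\<^sup>2) * k0 x y"
          using near 2 pos by (intro mult_right_mono) (auto dest!: bspec)
        also have "\<dots> = K * k x y" using k2[OF 2(1)] by (simp add: mult.assoc)
        also have "\<dots> \<le> G y" using 2 rs nn pos by (simp add: G_def g_def)
        finally show ?thesis .
      next
        case 3
        then have ne: "y \<noteq> x" using rs by auto
        have "F y = (u x - u y) * k0 x y" using 3 by (simp add: F_eq)
        also have "\<dots> \<le> (m (y - x) + B * (norm (x - y))\<^sup>2 + \<delta>) * k0 x y"
          using mid 3 pos by (intro mult_right_mono) auto
        also have "\<dots> = k0 x y * m (y - x) + B * k x y + \<delta> * k0 x y"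
          using k2[OF ne] by (simp add: algebra_simps)
        also have "\<dots> = G y" using 3 by (simp add: G_def g_def)
        finally show ?thesis by simp
      next
        case 4
        have "F y = (u x - u y) * k0 x y" using 4 by (simp add: F_eq)
        also have "\<dots> \<le> (2 * M) * k0 x y"
          using ux elim pos by (intro mult_right_mono) auto
        also have "\<dots> \<le> G y" using 4 nn pos by (simp add: G_def g_def)
        finally show ?thesis .
      qed
    qed
    have i: "integrable lebesgue (\<lambda>y. K * (indicator (ball x r) y * k x y))"
        "integrable lebesgue (\<lambda>y. \<delta> * (indicator (- ball x r) y * k0 x y))"
        "integrable lebesgue (\<lambda>y. B * (indicator (ball x s) y * k x y))"
        "integrable lebesgue (\<lambda>y. 2 * M * (indicator (- ball x s) y * k0 x y))"
      using C1 C2 rs s by auto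
    have "integrable lebesgue G" unfolding G_def using i g(1) by (intro Bochner_Integration.integrable_add)
    then have "integral\<^sup>L lebesgue F \<le> integral\<^sup>L lebesgue G" by (rule integral_mono_AE[OF F(1) _ FG])
    also have "\<dots> = K * (LINT y|lebesgue. indicator (ball x r) y * k x y) + \<delta> * (LINT y|lebesgue. indicator (- ball x r) y * k0 x y)
        + B * (LINT y|lebesgue. indicator (ball x s) y * k x y) + 2 * M * (LINT y|lebesgue. indicator (- ball x s) y * k0 x y)"
      unfolding G_def using i g by simp
    also have "\<dots> \<le> K * (C1 * r powr (2 - 2 * \<sigma>)) + \<delta> * (C2 * r powr (- (2 * \<sigma>)))
        + B * (C1 * s powr (2 - 2 * \<sigma>)) + 2 * M * (C2 * s powr (- (2 * \<sigma>)))"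
      using C1 C2 rs s nn M by (intro add_mono mult_left_mono) auto
    \<comment> \<open>One constant serves all four terms; the factor 2 stems from the bound
      \<open>2 * M\<close> for the difference of two values of \<open>u\<close>.\<close>
    also have "\<dots> \<le> (C1 + 2 * C2) * (K * r powr (2 - 2 * \<sigma>)) + (C1 + 2 * C2) * (\<delta> * r powr (- (2 * \<sigma>)))
        + (C1 + 2 * C2) * (B * s powr (2 - 2 * \<sigma>)) + (C1 + 2 * C2) * (M * s powr (- (2 * \<sigma>)))"
    proof -
      have "K * (C1 * a) \<le> (C1 + 2 * C2) * (K * a)" "B * (C1 * a) \<le> (C1 + 2 * C2) * (B * a)"
        "\<delta> * (C2 * a) \<le> (C1 + 2 * C2) * (\<delta> * a)" "2 * M * (C2 * a) \<le> (C1 + 2 * C2) * (M * a)" if "a \<ge> 0" for a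
        using nn M that C1_nonneg C2_nonneg by (simp_all add: algebra_simps)
      then show ?thesis by (intro add_mono) auto
    qed
    finally show "frac_laplacian_pv \<sigma> u x \<le>
      (C1 + 2 * C2) * (K * r powr (2 - 2 * \<sigma>) + \<delta> * r powr (- (2 * \<sigma>)) + B * s powr (2 - 2 * \<sigma>) + M * s powr (- (2 * \<sigma>)))"
      using F(2) by (simp add: distrib_left)
  qed
qed

subsection \<open>Second derivatives\<close>

text \<open>A negative \<open>D\<close> would make \<open>g'\<close> negative just to the right of
  its zero at 0, and by the mean value theorem \<open>g\<close> would fall below
  \<open>g 0\<close>.\<close>

lemma second_derivative_nonneg_at_min:
  fixes g g' :: "real \<Rightarrow> real"
  assumes "d > 0" and g: "\<And>t. \<bar>t\<bar> < d \<Longrightarrow> (g has_real_derivative g' t) (at t)"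
    and g2: "(g' has_real_derivative D) (at 0)"
    and min: "\<And>t. \<bar>t\<bar> < d \<Longrightarrow> g 0 \<le> g t"
  shows "D \<ge> 0"
proof (rule ccontr)
  assume "\<not> D \<ge> 0"
  then have "D < 0" by simp
  have g0: "g' 0 = 0"
    using DERIV_local_min[OF g[of 0] \<open>d > 0\<close>] min \<open>d > 0\<close> by auto
  obtain e where e: "e > 0" "\<And>h. 0 < h \<Longrightarrow> h < e \<Longrightarrow> g' h < 0"
    using DERIV_neg_dec_right[OF g2 \<open>D < 0\<close>] g0 by auto
  define t where "t = min d e / 2"
  have t: "0 < t" "t < d" "t < e" using \<open>d > 0\<close> e(1) by (auto simp: t_def)
  have "\<exists>z>0. z < t \<and> g t - g 0 = (t - 0) * g' z"
    using t by (intro MVT2 g) auto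
  then obtain z where z: "0 < z" "z < t" "g t - g 0 = (t - 0) * g' z" by blast
  then have "g t - g 0 < 0" using e(2)[of z] t by (simp add: mult_pos_neg)
  then show False using min[of t] t by simp
qed

lemma line_has_derivative:
  fixes f :: "'a::real_normed_vector \<Rightarrow> 'b::real_normed_vector"
  assumes "(f has_derivative f') (at (x + t *\<^sub>R e))"
  shows "((\<lambda>t. f (x + t *\<^sub>R e)) has_vector_derivative f' e) (at t)"
proof -
  have "((\<lambda>t. x + t *\<^sub>R e) has_derivative (\<lambda>h. h *\<^sub>R e)) (at t)"
    by (auto intro!: derivative_eq_intros)
  from has_derivative_compose[OF this assms]
  have "((\<lambda>t. f (x + t *\<^sub>R e)) has_derivative (\<lambda>h. f' (h *\<^sub>R e))) (at t)" .
  then show ?thesis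
    using linear_cmul[OF bounded_linear.linear[OF has_derivative_bounded_linear[OF assms]]]
    by (simp add: has_vector_derivative_def)
qed

lemma C2_line_derivatives:
  fixes u :: "'a::real_normed_vector \<Rightarrow> real" and u'' :: "'a \<Rightarrow> 'a \<Rightarrow>\<^sub>L 'a \<Rightarrow>\<^sub>L real"
  assumes "\<And>x. x \<in> S \<Longrightarrow> (u has_derivative blinfun_apply (u' x)) (at x)"
    and "\<And>x. x \<in> S \<Longrightarrow> (u' has_derivative blinfun_apply (u'' x)) (at x)" and "x + t *\<^sub>R e \<in> S"
  shows "((\<lambda>t. u (x + t *\<^sub>R e)) has_real_derivative u' (x + t *\<^sub>R e) e) (at t)"
    and "((\<lambda>t. u' (x + t *\<^sub>R e) e) has_real_derivative u'' (x + t *\<^sub>R e) e e) (at t)"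
proof -
  show "((\<lambda>t. u (x + t *\<^sub>R e)) has_real_derivative u' (x + t *\<^sub>R e) e) (at t)"
    using line_has_derivative[OF assms(1)[OF assms(3)]] by (simp add: has_real_derivative_iff_has_vector_derivative)
  have "((\<lambda>t. u' (x + t *\<^sub>R e)) has_vector_derivative u'' (x + t *\<^sub>R e) e) (at t)"
    by (rule line_has_derivative[OF assms(2)[OF assms(3)]])
  then have "((\<lambda>t. u' (x + t *\<^sub>R e) e) has_vector_derivative u'' (x + t *\<^sub>R e) e e) (at t)"
    by (rule bounded_linear.has_vector_derivative[OF blinfun.bounded_linear_left])
  then show "((\<lambda>t. u' (x + t *\<^sub>R e) e) has_real_derivative u'' (x + t *\<^sub>R e) e e) (at t)"
    by (simp add: has_real_derivative_iff_has_vector_derivative)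
qed

lemma line_in_open:
  fixes x e :: "'a::real_normed_vector"
  assumes "open S" "x \<in> S"
  obtains d where "d > 0" "\<And>t. \<bar>t\<bar> < d \<Longrightarrow> x + t *\<^sub>R e \<in> S"
proof -
  obtain r where r: "r > 0" "ball x r \<subseteq> S" using assms by (meson open_contains_ball)
  show ?thesis
  proof
    \<comment> \<open>The \<open>+ 1\<close> keeps the denominator positive for
      \<open>e = 0\<close>.\<close>
    show "r / (norm e + 1) > 0" using r by (simp add: add_nonneg_pos)
    fix t assume "\<bar>t\<bar> < r / (norm e + 1)"
    then have "\<bar>t\<bar> * (norm e + 1) < r" by (simp add: pos_less_divide_eq add_nonneg_pos)
    then have "\<bar>t\<bar> * norm e + \<bar>t\<bar> < r" by (simp add: distrib_left)
    then have "\<bar>t\<bar> * norm e < r" using abs_ge_zero[of t] by linarith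
    then show "x + t *\<^sub>R e \<in> S" using r(2) by (auto simp: dist_norm subset_iff)
  qed
qed

text \<open>Since \<open>laplacian\<close> iterates \<open>deriv\<close>, the first derivative along
  a line must be identified on a whole neighbourhood of 0 before it can be differentiated again;
  openness of \<open>S\<close> provides that neighbourhood.\<close>

lemma laplacian_eq_trace:
  fixes u :: "real ^ 'n \<Rightarrow> real"
  assumes "open S" "x \<in> S"
    and u: "\<And>x. x \<in> S \<Longrightarrow> (u has_derivative blinfun_apply (u' x)) (at x)"
    and u': "\<And>x. x \<in> S \<Longrightarrow> (u' has_derivative blinfun_apply (u'' x)) (at x)"
  shows "laplacian u x = (\<Sum>i\<in>UNIV. u'' x (axis i 1) (axis i 1))"
  unfolding laplacian_def
proof (rule sum.cong[OF refl])
  fix i :: 'n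
  let ?e = "axis i 1 :: real ^ 'n"
  obtain d where d: "d > 0" "\<And>t. \<bar>t\<bar> < d \<Longrightarrow> x + t *\<^sub>R ?e \<in> S"
    using line_in_open[OF assms(1,2)] by metis
  have "\<forall>\<^sub>F t in nhds 0. \<bar>t\<bar> < d"
    using d(1) eventually_nhds_metric[of "\<lambda>t. \<bar>t\<bar> < d" "0::real"] by auto
  then have "\<forall>\<^sub>F t in nhds 0. deriv (\<lambda>t. u (x + t *\<^sub>R ?e)) t = u' (x + t *\<^sub>R ?e) ?e"
    by eventually_elim (intro DERIV_imp_deriv C2_line_derivatives(1)[OF u u' d(2)])
  then have "deriv (deriv (\<lambda>t. u (x + t *\<^sub>R ?e))) 0 = deriv (\<lambda>t. u' (x + t *\<^sub>R ?e) ?e) 0"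
    by (intro deriv_cong_ev) auto
  also have "\<dots> = u'' x ?e ?e"
    using C2_line_derivatives(2)[OF u u', where x=x and t=0 and e="?e"] assms(2) by (intro DERIV_imp_deriv) simp
  finally show "(deriv ^^ 2) (\<lambda>t. u (x + t *\<^sub>R ?e)) 0 = u'' x ?e ?e" by (simp add: numeral_2_eq_2)
qed

text \<open>The mean value inequality is used twice: for \<open>u'\<close> on the ball, which gives
  the Lipschitz constant \<open>K\<close>, and for the linearization of \<open>u\<close> on the
  segment. This yields \<open>K\<close> in place of the sharper \<open>K / 2\<close>.\<close>

lemma taylor_quadratic_bound:
  fixes u :: "'a::real_normed_vector \<Rightarrow> real"
  assumes u: "\<And>z. z \<in> ball x r \<Longrightarrow> (u has_derivative blinfun_apply (u' z)) (at z)"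
    and u': "\<And>z. z \<in> ball x r \<Longrightarrow> (u' has_derivative blinfun_apply (u'' z)) (at z)"
    and K: "\<And>z. z \<in> ball x r \<Longrightarrow> norm (u'' z) \<le> K" and y: "y \<in> ball x r"
  shows "\<bar>u x - u y + u' x (y - x)\<bar> \<le> K * (norm (x - y))\<^sup>2"
proof -
  have seg: "closed_segment x y \<subseteq> ball x r"
    using y by (intro closed_segment_subset) (auto intro: le_less_trans[OF zero_le_dist])
  have xr: "x \<in> ball x r" using y by (auto intro: le_less_trans[OF zero_le_dist])
  have K0: "K \<ge> 0" using K[OF xr] norm_ge_zero order_trans by blast
  have "norm (u y - u x - blinfun_apply (u' x) (y - x)) \<le> norm (y - x) * (K * norm (y - x))"
  proof (rule differentiable_bound_linearization[where S="closed_segment x y" and f'="\<lambda>z. blinfun_apply (u' z)"])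
    show "x + t *\<^sub>R (y - x) \<in> closed_segment x y" if "t \<in> {0..1}" for t
      using that by (auto simp: closed_segment_def algebra_simps intro!: exI[of _ t])
    show "(u has_derivative blinfun_apply (u' z)) (at z within closed_segment x y)" if "z \<in> closed_segment x y" for z
      by (rule has_derivative_at_withinI, rule u) (use seg that in blast)
    fix z assume z: "z \<in> closed_segment x y"
    have "norm (u' z - u' x) \<le> K * norm (z - x)"
      by (rule differentiable_bound[where S="ball x r" and f'="\<lambda>z. blinfun_apply (u'' z)"])
         (use u' K subsetD[OF seg z] xr in \<open>auto intro: has_derivative_at_withinI simp: norm_blinfun.rep_eq[symmetric]\<close>)
    also have "\<dots> \<le> K * norm (y - x)"
      using segment_bound1[OF z] K0 by (intro mult_left_mono)
    finally show "onorm (blinfun_apply (u' z) - blinfun_apply (u' x)) \<le> K * norm (y - x)"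
      by (simp add: norm_blinfun.rep_eq minus_blinfun.rep_eq fun_diff_def)
  qed simp
  then show ?thesis by (simp add: power2_eq_square norm_minus_commute mult_ac)
qed

text \<open>A null set contains no ball. This allows a point to be moved slightly into the set where
  an almost everywhere property holds.\<close>

lemma AE_lebesgue_imp_ex_ball:
  fixes a :: "'a::euclidean_space"
  assumes "AE x in lebesgue. P x" "r > 0"
  shows "\<exists>x\<in>ball a r. P x"
proof (rule ccontr)
  assume "\<not> ?thesis"
  then have "AE x in lebesgue. x \<notin> ball a r" using assms(1) by (auto elim: eventually_mono)
  then have "emeasure lebesgue (ball a r) = 0"
    by (subst (asm) AE_iff_measurable[of "ball a r"]) auto
  then show False using content_ball_gt_0_iff[of a r] assms(2) by (simp add: measure_def)
qed

subsection \<open>Touching from below\<close>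

text \<open>\<open>P\<close> will be the equation together with the lower bound for
  \<open>f\<close>. Minimizing \<open>u\<close> plus a paraboloid controls the Hessian from below
  and gives a one-sided quadratic bound for \<open>u\<close>. \<open>D\<close> is quantified before
  \<open>u\<close>, so it cannot depend on the size of the second derivatives.\<close>

lemma touching_point_estimate:
  assumes \<sigma>: "0 < \<sigma>" "\<sigma> < 1"
  shows "\<exists>D\<ge>0. \<forall>(u :: real ^ 'n \<Rightarrow> real) u' u'' S x\<^sub>0 \<rho> \<epsilon> M P.
    u \<in> borel_measurable lebesgue \<longrightarrow> (AE y in lebesgue. \<bar>u y\<bar> \<le> M) \<longrightarrow> 0 \<le> M \<longrightarrow> open S \<longrightarrow>
    (\<forall>x\<in>S. (u has_derivative blinfun_apply (u' x)) (at x)) \<longrightarrow>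
    (\<forall>x\<in>S. (u' has_derivative blinfun_apply (u'' x)) (at x)) \<longrightarrow> continuous_on S u'' \<longrightarrow>
    cball x\<^sub>0 \<rho> \<subseteq> S \<longrightarrow> 0 < \<rho> \<longrightarrow> \<rho> \<le> 1 \<longrightarrow> 0 < \<epsilon> \<longrightarrow>
    (\<forall>y\<in>cball x\<^sub>0 \<rho>. u x\<^sub>0 - u y \<le> \<epsilon> / 8) \<longrightarrow> (AE x in lebesgue. x \<in> S \<longrightarrow> P x) \<longrightarrow>
    (\<exists>x\<in>ball x\<^sub>0 \<rho>. P x \<and> - laplacian u x \<le> real CARD('n) * (3 * (\<epsilon> / \<rho>\<^sup>2)) \<and>
      frac_laplacian_pv \<sigma> u x \<le> D * (2 + \<epsilon> + 16 * M) * \<rho> powr (- (2 * \<sigma>)))"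
proof -
  from pv_upper_bound[OF \<sigma>, where 'n='n] obtain C where C: "C \<ge> 0" and pv:
    "\<forall>(u :: real ^ 'n \<Rightarrow> real) x l m K B \<delta> M r s.
    u \<in> borel_measurable lebesgue \<longrightarrow> (AE y in lebesgue. \<bar>u y\<bar> \<le> M) \<longrightarrow> \<bar>u x\<bar> \<le> M \<longrightarrow>
    bounded_linear l \<longrightarrow> bounded_linear m \<longrightarrow> 0 < r \<longrightarrow> r \<le> s \<longrightarrow> 0 \<le> K \<longrightarrow> 0 \<le> B \<longrightarrow> 0 \<le> \<delta> \<longrightarrow>
    (\<forall>y\<in>ball x r. \<bar>u x - u y + l (y - x)\<bar> \<le> K * (norm (x - y))\<^sup>2) \<longrightarrow>
    (\<forall>y\<in>ball x s. u x - u y \<le> m (y - x) + B * (norm (x - y))\<^sup>2 + \<delta>) \<longrightarrow>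
    frac_laplacian_pv \<sigma> u x \<le>
      C * (K * r powr (2 - 2 * \<sigma>) + \<delta> * r powr (- (2 * \<sigma>)) + B * s powr (2 - 2 * \<sigma>) + M * s powr (- (2 * \<sigma>)))"
    by (elim exE conjE)
  show ?thesis
  proof (intro exI[of _ C] conjI allI impI C)
    fix u :: "real ^ 'n \<Rightarrow> real" and u' u'' S x\<^sub>0 and \<rho> \<epsilon> M :: real and P
    assume um: "u \<in> borel_measurable lebesgue" and M: "AE y in lebesgue. \<bar>u y\<bar> \<le> M" "0 \<le> M" and "open S"
      and u': "\<forall>x\<in>S. (u has_derivative blinfun_apply (u' x)) (at x)"
      and u'': "\<forall>x\<in>S. (u' has_derivative blinfun_apply (u'' x)) (at x)" and cont: "continuous_on S u''"
      and sub: "cball x\<^sub>0 \<rho> \<subseteq> S" and \<rho>: "0 < \<rho>" "\<rho> \<le> 1" and \<epsilon>: "0 < \<epsilon>"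
      and osc: "\<forall>y\<in>cball x\<^sub>0 \<rho>. u x\<^sub>0 - u y \<le> \<epsilon> / 8" and P: "AE x in lebesgue. x \<in> S \<longrightarrow> P x"
    define A where "A = \<epsilon> / \<rho>\<^sup>2"
    have A: "A > 0" using \<epsilon> \<rho> by (simp add: A_def)
    define h where "h = (\<lambda>x. u x + A * ((x - x\<^sub>0) \<bullet> (x - x\<^sub>0)))"
    have contu: "continuous_on S u"
      using u' by (meson has_derivative_continuous continuous_at_imp_continuous_on)
    then have conth: "continuous_on S h" unfolding h_def by (intro continuous_intros)
    \<comment> \<open>The minimum point of \<open>h\<close> may lie in the null set where \<open>P\<close> fails. The estimates are therefore
      made at a nearby point of the full set, with errors \<open>A\<close> in the Hessian and \<open>\<delta>\<close> in \<open>h\<close>.\<close>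
    obtain z where z: "z \<in> cball x\<^sub>0 \<rho>" and hz: "\<And>y. y \<in> cball x\<^sub>0 \<rho> \<Longrightarrow> h z \<le> h y"
      using continuous_attains_inf[of "cball x\<^sub>0 \<rho>" h] continuous_on_subset[OF conth sub] \<rho> by force
    \<comment> \<open>Comparing \<open>h\<close> at \<open>z\<close> and at the centre bounds the
      squared distance by \<open>\<rho>\<^sup>2 / 8\<close>, which is less than
      \<open>(\<rho> / 2)\<^sup>2\<close>. The minimum is therefore interior.\<close>
    have "dist x\<^sub>0 z < \<rho> / 2"
    proof -
      have "A * (dist x\<^sub>0 z)\<^sup>2 = A * ((z - x\<^sub>0) \<bullet> (z - x\<^sub>0))" 
        by (simp add: dist_norm norm_minus_commute dot_square_norm)
      also have "\<dots> \<le> u x\<^sub>0 - u z" using hz[of x\<^sub>0] \<rho> by (simp add: h_def)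
      also have "\<dots> \<le> \<epsilon> / 8" using osc z by blast
      finally have "A * (dist x\<^sub>0 z)\<^sup>2 \<le> \<epsilon> / 8" .
      then have "(dist x\<^sub>0 z)\<^sup>2 \<le> \<rho>\<^sup>2 / 8" using \<epsilon> \<rho> by (simp add: A_def field_simps)
      also have "\<dots> < (\<rho> / 2)\<^sup>2" using \<rho> by (simp add: power_divide)
      finally show ?thesis using \<rho> by (intro power2_less_imp_less[of _ "\<rho> / 2"]) auto
    qed
    then have zS: "z \<in> S" using sub \<rho> by auto
    define a where "a = \<rho> / 2 - dist x\<^sub>0 z"
    have a: "a > 0" using \<open>dist x\<^sub>0 z < \<rho> / 2\<close> by (simp add: a_def)
    have ball_a: "ball z a \<subseteq> ball x\<^sub>0 (\<rho> / 2)"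
    proof
      fix y assume "y \<in> ball z a"
      then show "y \<in> ball x\<^sub>0 (\<rho> / 2)" using dist_triangle[of x\<^sub>0 y z] by (simp add: a_def)
    qed
    \<comment> \<open>Along each line \<open>h\<close> has a local minimum at \<open>z\<close>, and
      the paraboloid contributes \<open>2 * A\<close> to its second derivative.\<close>
    have hess: "u'' z e e \<ge> - 2 * A" if "norm e = 1" for e
    proof -
      have uS: "x \<in> S \<Longrightarrow> (u has_derivative blinfun_apply (u' x)) (at x)" 
        "x \<in> S \<Longrightarrow> (u' has_derivative blinfun_apply (u'' x)) (at x)" for x using u' u'' by auto
      have in_ball: "z + t *\<^sub>R e \<in> ball z a" if "\<bar>t\<bar> < a" for t using that \<open>norm e = 1\<close> by (simp add: dist_norm)
      have in_cball: "z + t *\<^sub>R e \<in> cball x\<^sub>0 \<rho>" if "\<bar>t\<bar> < a" for t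
        using in_ball[OF that] ball_a \<rho> by (auto simp: subset_iff)
      have in_S: "z + t *\<^sub>R e \<in> S" if "\<bar>t\<bar> < a" for t
        using in_cball[OF that] sub by blast
      have quad: "(z + t *\<^sub>R e - x\<^sub>0) \<bullet> (z + t *\<^sub>R e - x\<^sub>0) = (z - x\<^sub>0) \<bullet> (z - x\<^sub>0) + 2 * t * (e \<bullet> (z - x\<^sub>0)) + t\<^sup>2" for t
        using \<open>norm e = 1\<close> by (simp add: norm_eq_1 algebra_simps inner_commute power2_eq_square)
      have "0 \<le> u'' z e e + 2 * A"
      proof (rule second_derivative_nonneg_at_min[OF a])
        show "((\<lambda>t. h (z + t *\<^sub>R e)) has_real_derivative u' (z + t *\<^sub>R e) e + A * (2 * (e \<bullet> (z - x\<^sub>0)) + 2 * t)) (at t)"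
          if "\<bar>t\<bar> < a" for t
          unfolding h_def quad
          by (rule derivative_eq_intros C2_line_derivatives(1)[OF uS in_S[OF that]] refl | assumption)+ simp
        show "((\<lambda>t. u' (z + t *\<^sub>R e) e + A * (2 * (e \<bullet> (z - x\<^sub>0)) + 2 * t)) has_real_derivative u'' z e e + 2 * A) (at 0)"
          using C2_line_derivatives(2)[OF uS in_S[of 0]] a
          by (auto intro!: derivative_eq_intros)
        show "h (z + 0 *\<^sub>R e) \<le> h (z + t *\<^sub>R e)" if "\<bar>t\<bar> < a" for t
          using hz[OF in_cball[OF that]] by simp
      qed
      then show ?thesis by simp
    qed
    define K where "K = norm (u'' z) + A"
    have K: "K > 0" using A by (simp add: K_def add_nonneg_pos)
    obtain b where b: "b > 0" "\<And>y. y \<in> ball z b \<Longrightarrow> y \<in> S \<and> norm (u'' y - u'' z) \<le> A"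
    proof -
      have "isCont u'' z" using cont \<open>open S\<close> zS by (simp add: continuous_on_eq_continuous_at)
      then obtain b1 where b1: "b1 > 0" "\<And>y. dist y z < b1 \<Longrightarrow> dist (u'' y) (u'' z) < A"
        unfolding continuous_at_eps_delta using A by blast
      obtain b2 where b2: "b2 > 0" "ball z b2 \<subseteq> S" using \<open>open S\<close> zS by (meson open_contains_ball)
      show ?thesis
        by (rule that[of "min b1 b2"]) (use b1 b2 in \<open>auto simp: dist_commute dist_norm[symmetric] subset_iff intro: less_imp_le\<close>)
    qed
    have normK: "norm (u'' y) \<le> K" if "y \<in> ball z b" for y
      using b(2)[OF that] norm_triangle_sub[of "u'' y" "u'' z"] by (simp add: K_def)
    \<comment> \<open>As \<open>x\<close> will be within \<open>\<rho> / 2\<close> of the centre,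
      \<open>ball x s\<close> stays inside the ball on which \<open>z\<close> is minimal.\<close>
    define s where "s = \<rho> / 4"
    \<comment> \<open>\<open>K\<close> has no bound in terms of \<open>\<rho>\<close>, so
      \<open>r\<close> is taken so small that the innermost contribution is at most 1.\<close>
    obtain r where r: "r > 0" "r \<le> b / 2" "r \<le> s" "K * r powr (2 - 2 * \<sigma>) \<le> 1"
    proof -
      define t where "t = min (min (b / 2) s) ((1 / K) powr (1 / (2 - 2 * \<sigma>)))"
      have t: "t > 0" using b(1) \<rho> K by (simp add: t_def s_def)
      have "t powr (2 - 2 * \<sigma>) \<le> ((1 / K) powr (1 / (2 - 2 * \<sigma>))) powr (2 - 2 * \<sigma>)"
        using t \<sigma> by (intro powr_mono2) (auto simp: t_def)
      also have "\<dots> = 1 / K" using K \<sigma> by (simp add: powr_powr)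
      finally have "K * t powr (2 - 2 * \<sigma>) \<le> 1" using K by (simp add: field_simps)
      then show ?thesis using t by (intro that[of t]) (auto simp: t_def)
    qed
    \<comment> \<open>\<open>\<delta>\<close> is fixed after \<open>r\<close> so that its
      contribution is exactly 1; the point \<open>x\<close> is chosen only afterwards.\<close>
    define \<delta> where "\<delta> = r powr (2 * \<sigma>)"
    have \<delta>: "\<delta> > 0" "\<delta> * r powr (- (2 * \<sigma>)) = 1" using r(1) by (simp_all add: \<delta>_def powr_minus)
    obtain c where c: "c > 0" "\<And>y. y \<in> ball z c \<Longrightarrow> h y \<le> h z + \<delta>"
    proof -
      have "isCont h z" using conth \<open>open S\<close> zS by (simp add: continuous_on_eq_continuous_at)
      then obtain c where c: "c > 0" "\<And>y. dist y z < c \<Longrightarrow> dist (h y) (h z) < \<delta>"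
        unfolding continuous_at_eps_delta using \<delta>(1) by blast
      have "h y \<le> h z + \<delta>" if "y \<in> ball z c" for y
        using c(2)[of y] that by (simp add: dist_commute dist_real_def abs_less_iff)
      with c(1) show ?thesis by (rule that)
    qed
    have "AE x in lebesgue. \<bar>u x\<bar> \<le> M \<and> (x \<in> S \<longrightarrow> P x)" using M(1) P by eventually_elim simp
    \<comment> \<open>The radius \<open>a\<close> keeps \<open>x\<close> in the half ball,
      \<open>b / 2\<close> keeps \<open>ball x r\<close> inside \<open>ball z b\<close>, and
      \<open>c\<close> gives \<open>h x \<le> h z + \<delta>\<close>.\<close>
    then obtain x where x: "x \<in> ball z (min (min a (b / 2)) c)" and ux: "\<bar>u x\<bar> \<le> M" "x \<in> S \<longrightarrow> P x"
      using AE_lebesgue_imp_ex_ball[of "\<lambda>x. \<bar>u x\<bar> \<le> M \<and> (x \<in> S \<longrightarrow> P x)" "min (min a (b / 2)) c" z] a b(1) c(1) by auto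
    have x0: "x \<in> ball x\<^sub>0 (\<rho> / 2)" using x ball_a by auto
    have xS: "x \<in> S" using x0 sub \<rho> by (auto simp: subset_iff)
    \<comment> \<open>Each of the second derivatives in the trace is at least \<open>- 2 * A\<close>
      at \<open>z\<close> and loses at most \<open>A\<close> on the way to \<open>x\<close>.\<close>
    have "- laplacian u x \<le> real CARD('n) * (3 * A)"
    proof -
      have "u'' x (axis i 1) (axis i 1) \<ge> - (3 * A)" for i
      proof -
        let ?e = "axis i 1 :: real ^ 'n"
        have "\<bar>(u'' x - u'' z) ?e ?e\<bar> \<le> norm ((u'' x - u'' z) ?e) * norm ?e"
          using norm_blinfun[of "(u'' x - u'' z) ?e" ?e] by simp
        also have "\<dots> \<le> norm (u'' x - u'' z) * norm ?e * norm ?e"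
          by (intro mult_right_mono norm_blinfun) auto
        also have "\<dots> \<le> A" using b(2)[of x] x b(1) by (simp add: norm_axis_1)
        finally have "\<bar>u'' x ?e ?e - u'' z ?e ?e\<bar> \<le> A" by (simp add: blinfun.diff_left)
        then show ?thesis using hess[of ?e] by (simp add: norm_axis_1)
      qed
      then have "(\<Sum>i\<in>(UNIV::'n set). - (3 * A)) \<le> (\<Sum>i\<in>UNIV. u'' x (axis i 1) (axis i 1))"
        by (intro sum_mono)
      then show ?thesis
        using laplacian_eq_trace[OF \<open>open S\<close> xS, of u u' u''] u' u'' by simp
    qed
    moreover have "frac_laplacian_pv \<sigma> u x \<le> C * (2 + \<epsilon> + 16 * M) * \<rho> powr (- (2 * \<sigma>))"
    proof -
      have near: "\<forall>y\<in>ball x r. \<bar>u x - u y + u' x (y - x)\<bar> \<le> K * (norm (x - y))\<^sup>2"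
      proof
        fix y assume y: "y \<in> ball x r"
        have "ball x r \<subseteq> ball z b"
        proof
          fix w assume "w \<in> ball x r"
          then have "dist z w \<le> dist z x + dist x w" "dist x w < b / 2" using dist_triangle r by auto
          then show "w \<in> ball z b" using x by simp
        qed
        then show "\<bar>u x - u y + u' x (y - x)\<bar> \<le> K * (norm (x - y))\<^sup>2"
          using b(2) u' u'' normK by (intro taylor_quadratic_bound[where r=r and u''=u''] y) blast+
      qed
      define m where "m = (\<lambda>v. 2 * A * ((x - x\<^sub>0) \<bullet> v))"
      have m: "bounded_linear m" unfolding m_def
        by (intro bounded_linear_const_mult bounded_linear_inner_right)
      \<comment> \<open>This is \<open>h x \<le> h z + \<delta> \<le> h y + \<delta>\<close> with
        the paraboloid expanded around \<open>x\<close>; \<open>m\<close> is its linear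
        part.\<close>
      have mid: "\<forall>y\<in>ball x s. u x - u y \<le> m (y - x) + A * (norm (x - y))\<^sup>2 + \<delta>"
      proof
        fix y assume y: "y \<in> ball x s"
        have "dist x\<^sub>0 y \<le> dist x\<^sub>0 x + dist x y" by (rule dist_triangle)
        then have "y \<in> cball x\<^sub>0 \<rho>" using y x0 \<rho>(1) by (simp add: s_def)
        then have "h x \<le> h y + \<delta>" using hz[of y] c(2)[of x] x by auto
        moreover have "(y - x\<^sub>0) \<bullet> (y - x\<^sub>0) = (x - x\<^sub>0) \<bullet> (x - x\<^sub>0) + 2 * ((x - x\<^sub>0) \<bullet> (y - x)) + (norm (x - y))\<^sup>2"
          by (simp add: power2_norm_eq_inner algebra_simps inner_commute)
        then have "h y = u y + A * ((x - x\<^sub>0) \<bullet> (x - x\<^sub>0)) + m (y - x) + A * (norm (x - y))\<^sup>2"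
          by (simp add: h_def m_def distrib_left)
        moreover have "h x = u x + A * ((x - x\<^sub>0) \<bullet> (x - x\<^sub>0))" by (simp add: h_def)
        ultimately show "u x - u y \<le> m (y - x) + A * (norm (x - y))\<^sup>2 + \<delta>" by linarith
      qed
      have "frac_laplacian_pv \<sigma> u x \<le> C * (K * r powr (2 - 2 * \<sigma>) + \<delta> * r powr (- (2 * \<sigma>))
          + A * s powr (2 - 2 * \<sigma>) + M * s powr (- (2 * \<sigma>)))"
        using pv[rule_format, OF um M(1) ux(1) blinfun.bounded_linear_right m r(1) r(3) less_imp_le[OF K]
            less_imp_le[OF A] less_imp_le[OF \<delta>(1)] near[rule_format] mid[rule_format]] .
      \<comment> \<open>The first two terms are at most 1, hence at most
        \<open>\<rho> powr (- (2 * \<sigma>))\<close> because \<open>\<rho> \<le> 1\<close>. In the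
        third, \<open>A * \<rho>\<^sup>2\<close> is \<open>\<epsilon>\<close>. The 16 bounds
        \<open>4 powr (2 * \<sigma>)\<close>, which comes from
        \<open>s = \<rho> / 4\<close>.\<close>
      also have "\<dots> \<le> C * (\<rho> powr (- (2 * \<sigma>)) + \<rho> powr (- (2 * \<sigma>))
          + \<epsilon> * \<rho> powr (- (2 * \<sigma>)) + M * (16 * \<rho> powr (- (2 * \<sigma>))))"
      proof (intro mult_left_mono add_mono C)
        have one: "1 \<le> \<rho> powr (- (2 * \<sigma>))" using \<rho> \<sigma> powr_mono'[of "- (2 * \<sigma>)" 0 \<rho>] by simp
        then show "K * r powr (2 - 2 * \<sigma>) \<le> \<rho> powr (- (2 * \<sigma>))" "\<delta> * r powr (- (2 * \<sigma>)) \<le> \<rho> powr (- (2 * \<sigma>))"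
          using r(4) \<delta>(2) by auto
        have "s powr (2 - 2 * \<sigma>) \<le> \<rho> powr (2 - 2 * \<sigma>)" using \<rho> \<sigma> by (intro powr_mono2) (auto simp: s_def)
        also have "\<dots> = \<rho>\<^sup>2 * \<rho> powr (- (2 * \<sigma>))" using \<rho> by (simp add: powr_diff powr_minus divide_inverse)
        finally have "A * s powr (2 - 2 * \<sigma>) \<le> A * (\<rho>\<^sup>2 * \<rho> powr (- (2 * \<sigma>)))" using A by simp
        then show "A * s powr (2 - 2 * \<sigma>) \<le> \<epsilon> * \<rho> powr (- (2 * \<sigma>))" using \<rho> by (simp add: A_def)
        have "4 powr (2 * \<sigma>) \<le> (4::real) powr 2" using \<sigma> by (intro powr_mono) auto
        then have "4 powr (2 * \<sigma>) * \<rho> powr (- (2 * \<sigma>)) \<le> 16 * \<rho> powr (- (2 * \<sigma>))"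
          by (intro mult_right_mono) auto
        moreover have "s powr (- (2 * \<sigma>)) = 4 powr (2 * \<sigma>) * \<rho> powr (- (2 * \<sigma>))"
          using \<rho> by (simp add: s_def powr_divide powr_minus field_simps)
        ultimately show "s powr (- (2 * \<sigma>)) \<le> 16 * \<rho> powr (- (2 * \<sigma>))" by simp
      qed (use M in auto)
      also have "\<dots> = C * (2 + \<epsilon> + 16 * M) * \<rho> powr (- (2 * \<sigma>))" by (simp add: algebra_simps)
      finally show ?thesis .
    qed
    ultimately show "\<exists>x\<in>ball x\<^sub>0 \<rho>. P x \<and> - laplacian u x \<le> real CARD('n) * (3 * (\<epsilon> / \<rho>\<^sup>2)) \<and>
      frac_laplacian_pv \<sigma> u x \<le> C * (2 + \<epsilon> + 16 * M) * \<rho> powr (- (2 * \<sigma>))"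
      using x0 \<rho> xS ux(2) by (intro bexI[of _ x]) (auto simp: A_def)
  qed
qed

text \<open>A ball is connected, so if it met both \<open>S\<close> and the complement it would
  contain a frontier point closer than the infimum of the distances. For an empty frontier
  \<open>infdist\<close> is 0 and the ball is empty.\<close>

lemma ball_infdist_frontier_subset:
  fixes x :: "'a::real_normed_vector"
  assumes "x \<in> S"
  shows "ball x (infdist x (frontier S)) \<subseteq> S"
proof (rule ccontr)
  assume "\<not> ?thesis"
  then have "ball x (infdist x (frontier S)) - S \<noteq> {}" by blast
  moreover from this have "infdist x (frontier S) > 0"
    by (metis ball_eq_empty empty_Diff not_less)
  then have "ball x (infdist x (frontier S)) \<inter> S \<noteq> {}" using assms by force
  ultimately have "ball x (infdist x (frontier S)) \<inter> frontier S \<noteq> {}"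
    by (intro connected_Int_frontier connected_ball)
  then obtain y where "y \<in> frontier S" "dist x y < infdist x (frontier S)" by auto
  then show False using infdist_le[of y "frontier S" x] by simp
qed

section \<open>Growth of \<open>f\<close> at the boundary against the touching estimate\<close>

theorem theorem1p4:
  fixes \<Omega> :: "(real ^ 'n) set" and \<sigma> \<kappa> :: real and f :: "real ^ 'n \<Rightarrow> real"
  assumes "open \<Omega>" and "connected \<Omega>" and "\<Omega> \<noteq> {}" and "bounded \<Omega>" and "C2_boundary \<Omega>"
    and "0 < \<sigma>" and "\<sigma> < 1"
    and "Linfty_loc \<Omega> f"
    and "\<kappa> > 0"
    and "AE x in lebesgue_on \<Omega>. (infdist x (frontier \<Omega>))\<^sup>2 * f x \<ge> \<kappa>"
  shows "\<forall>p::real. 1 \<le> p \<and> p < 1 / \<sigma> \<longrightarrow>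
    \<not> (\<exists>u :: real ^ 'n \<Rightarrow> real.
          Linfty_on UNIV u \<and> C2_on \<Omega> u \<and> continuous_on (closure \<Omega>) u \<and>
          (AE x in lebesgue_on \<Omega>.
             - laplacian u x
               + \<bar>frac_laplacian \<sigma> u x\<bar> powr (p - 1) * frac_laplacian \<sigma> u x = f x) \<and>
          (\<forall>x \<in> frontier \<Omega>. u x = 0) \<and>
          (AE x in lebesgue_on (- closure \<Omega>). u x = 0))"
proof (intro allI impI notI, elim exE conjE)
  fix p :: real and u :: "real ^ 'n \<Rightarrow> real"
  assume p: "1 \<le> p" "p < 1 / \<sigma>" and Linf: "Linfty_on UNIV u" and C2: "C2_on \<Omega> u"
    and contu: "continuous_on (closure \<Omega>) u"
    and eq: "AE x in lebesgue_on \<Omega>. - laplacian u x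
               + \<bar>frac_laplacian \<sigma> u x\<bar> powr (p - 1) * frac_laplacian \<sigma> u x = f x"
    and bdry: "\<forall>x \<in> frontier \<Omega>. u x = 0"
  note \<sigma> = \<open>0 < \<sigma>\<close> \<open>\<sigma> < 1\<close>
  obtain u' u'' where u': "\<forall>x\<in>\<Omega>. (u has_derivative blinfun_apply (u' x)) (at x)"
      and u'': "\<forall>x\<in>\<Omega>. (u' has_derivative blinfun_apply (u'' x)) (at x)" and cont: "continuous_on \<Omega> u''"
    using C2 unfolding C2_on_def by blast
  have um: "u \<in> borel_measurable lebesgue" using Linf by (simp add: Linfty_on_def lebesgue_on_UNIV_eq)
  obtain M0 where "AE y in lebesgue. \<bar>u y\<bar> \<le> M0" using Linf unfolding Linfty_on_def lebesgue_on_UNIV_eq by blast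
  then have M: "AE y in lebesgue. \<bar>u y\<bar> \<le> max M0 0" by eventually_elim simp
  define M where "M = max M0 0"
  define N where "N = real CARD('n)"
  have N: "N > 0" by (simp add: N_def)
  \<comment> \<open>The Laplacian will contribute \<open>27 * N * \<epsilon>\<close> to the final
    estimate, which this choice makes equal to \<open>\<kappa> / 2\<close>.\<close>
  define \<epsilon> where "\<epsilon> = \<kappa> / (54 * N)"
  have \<epsilon>: "\<epsilon> > 0" using N \<open>\<kappa> > 0\<close> by (simp add: \<epsilon>_def)
  define c where "c = frac_laplacian_const TYPE('n) \<sigma>"
  have c: "c > 0" unfolding c_def by (rule frac_laplacian_const_pos[OF \<sigma>])
  from touching_point_estimate[OF \<sigma>, where 'n='n] obtain D where D: "D \<ge> 0" and touch:
    "\<forall>(u :: real ^ 'n \<Rightarrow> real) u' u'' S x\<^sub>0 \<rho> \<epsilon> M P.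
    u \<in> borel_measurable lebesgue \<longrightarrow> (AE y in lebesgue. \<bar>u y\<bar> \<le> M) \<longrightarrow> 0 \<le> M \<longrightarrow> open S \<longrightarrow>
    (\<forall>x\<in>S. (u has_derivative blinfun_apply (u' x)) (at x)) \<longrightarrow>
    (\<forall>x\<in>S. (u' has_derivative blinfun_apply (u'' x)) (at x)) \<longrightarrow> continuous_on S u'' \<longrightarrow>
    cball x\<^sub>0 \<rho> \<subseteq> S \<longrightarrow> 0 < \<rho> \<longrightarrow> \<rho> \<le> 1 \<longrightarrow> 0 < \<epsilon> \<longrightarrow>
    (\<forall>y\<in>cball x\<^sub>0 \<rho>. u x\<^sub>0 - u y \<le> \<epsilon> / 8) \<longrightarrow> (AE x in lebesgue. x \<in> S \<longrightarrow> P x) \<longrightarrow>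
    (\<exists>x\<in>ball x\<^sub>0 \<rho>. P x \<and> - laplacian u x \<le> real CARD('n) * (3 * (\<epsilon> / \<rho>\<^sup>2)) \<and>
      frac_laplacian_pv \<sigma> u x \<le> D * (2 + \<epsilon> + 16 * M) * \<rho> powr (- (2 * \<sigma>)))"
    by (elim exE conjE)
  define E where "E = c * (D * (2 + \<epsilon> + 16 * M))"
  have E: "E \<ge> 0" using c D \<epsilon> by (simp add: E_def M_def)
  \<comment> \<open>This is where \<open>p < 1 / \<sigma>\<close> enters: the nonlinear term is of
    lower order than the growth of \<open>f\<close>.\<close>
  have exponent: "2 - 2 * \<sigma> * p > 0" using p \<sigma> by (simp add: field_simps)
  have "((\<lambda>t. E powr p * t powr (2 - 2 * \<sigma> * p)) \<longlongrightarrow> E powr p * 0 powr (2 - 2 * \<sigma> * p)) (at_right 0)"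
    using exponent by (intro tendsto_mult tendsto_const tendsto_powr' tendsto_ident_at)
      (auto simp: eventually_at_right_field intro: exI[of _ 1])
  then have "\<forall>\<^sub>F t in at_right 0. E powr p * t powr (2 - 2 * \<sigma> * p) < \<kappa> / 18"
    by (rule order_tendstoD) (use \<open>\<kappa> > 0\<close> in simp)
  then obtain \<rho>\<^sub>0 where \<rho>\<^sub>0: "\<rho>\<^sub>0 > 0" "\<And>t. 0 < t \<Longrightarrow> t < \<rho>\<^sub>0 \<Longrightarrow> E powr p * t powr (2 - 2 * \<sigma> * p) < \<kappa> / 18"
    unfolding eventually_at_right_field by auto
  have "\<Omega> \<noteq> UNIV" using \<open>bounded \<Omega>\<close> not_bounded_UNIV by auto
  then obtain z where z: "z \<in> frontier \<Omega>"
    using frontier_not_empty[of \<Omega>] \<open>\<Omega> \<noteq> {}\<close> by auto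
  then have zc: "z \<in> closure \<Omega>" by (simp add: frontier_def)
  obtain \<eta> where \<eta>: "\<eta> > 0" "\<And>x. x \<in> closure \<Omega> \<Longrightarrow> dist x z < \<eta> \<Longrightarrow> dist (u x) (u z) < \<epsilon> / 16"
    using contu zc \<epsilon> unfolding continuous_on_iff by (metis divide_pos_pos zero_less_numeral)
  \<comment> \<open>The bound \<open>\<eta> / 2\<close> keeps the ball of radius
    \<open>\<rho>\<close> within \<open>\<eta>\<close> of \<open>z\<close>, since
    \<open>\<rho>\<close> is at most half the distance to \<open>z\<close>; the other two bounds
    give \<open>\<rho> \<le> 1\<close> and the smallness of the nonlinear term.\<close>
  obtain x\<^sub>0 where x\<^sub>0: "x\<^sub>0 \<in> \<Omega>" "dist x\<^sub>0 z < min (min (\<eta> / 2) 1) \<rho>\<^sub>0"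
    using zc \<eta>(1) \<rho>\<^sub>0(1) closure_approachable[of z \<Omega>] by (metis half_gt_zero min_less_iff_conj zero_less_one)
  define d where "d = infdist x\<^sub>0 (frontier \<Omega>)"
  define \<rho> where "\<rho> = d / 2"
  have "d > 0"
  proof -
    have "x\<^sub>0 \<notin> frontier \<Omega>" using x\<^sub>0(1) \<open>open \<Omega>\<close> by (simp add: frontier_def interior_open)
    then show ?thesis unfolding d_def using z by (intro infdist_pos_not_in_closed) auto
  qed
  have dz: "d \<le> dist x\<^sub>0 z" unfolding d_def by (rule infdist_le[OF z])
  have \<rho>: "0 < \<rho>" "\<rho> \<le> 1" "\<rho> < \<rho>\<^sub>0" using \<open>d > 0\<close> dz x\<^sub>0(2) by (auto simp: \<rho>_def)
  have sub: "cball x\<^sub>0 \<rho> \<subseteq> \<Omega>"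
    using ball_infdist_frontier_subset[OF x\<^sub>0(1)] \<open>d > 0\<close> by (auto simp: \<rho>_def d_def[symmetric] subset_iff)
  \<comment> \<open>Both values are within \<open>\<epsilon> / 16\<close> of the boundary value
    \<open>u z\<close>.\<close>
  have osc: "\<forall>y\<in>cball x\<^sub>0 \<rho>. u x\<^sub>0 - u y \<le> \<epsilon> / 8"
  proof
    fix y assume y: "y \<in> cball x\<^sub>0 \<rho>"
    have "dist y z \<le> dist x\<^sub>0 y + dist x\<^sub>0 z" by (metis dist_commute dist_triangle)
    then have "dist y z < \<eta>" using y x\<^sub>0(2) dz \<open>d > 0\<close> by (simp add: \<rho>_def)
    then have "dist (u y) (u z) < \<epsilon> / 16" "dist (u x\<^sub>0) (u z) < \<epsilon> / 16"
      using \<eta>(2)[of y] \<eta>(2)[of x\<^sub>0] x\<^sub>0 y sub closure_subset[of \<Omega>] \<eta>(1) by (auto simp: subset_iff)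
    then show "u x\<^sub>0 - u y \<le> \<epsilon> / 8" unfolding dist_real_def by linarith
  qed
  define P where "P = (\<lambda>x. - laplacian u x + \<bar>frac_laplacian \<sigma> u x\<bar> powr (p - 1) * frac_laplacian \<sigma> u x = f x
    \<and> (infdist x (frontier \<Omega>))\<^sup>2 * f x \<ge> \<kappa>)"
  have "AE x in lebesgue_on \<Omega>. P x" using eq assms(10) unfolding P_def by eventually_elim simp
  then have P: "AE x in lebesgue. x \<in> \<Omega> \<longrightarrow> P x"
    using \<open>open \<Omega>\<close> by (subst (asm) AE_restrict_space_iff) auto
  obtain x where x: "x \<in> ball x\<^sub>0 \<rho>" "P x" and lap: "- laplacian u x \<le> N * (3 * (\<epsilon> / \<rho>\<^sup>2))"
    and pv: "frac_laplacian_pv \<sigma> u x \<le> D * (2 + \<epsilon> + 16 * M) * \<rho> powr (- (2 * \<sigma>))"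
    using touch[rule_format, of u M \<Omega> u' u'' x\<^sub>0 \<rho> \<epsilon> P] um M \<open>open \<Omega>\<close> u' u'' cont sub \<rho>(1,2) \<epsilon> osc P
    unfolding N_def M_def by auto
  \<comment> \<open>Positivity of the normalizing constant preserves the direction of the one-sided
    bound.\<close>
  have fl: "frac_laplacian \<sigma> u x \<le> E * \<rho> powr (- (2 * \<sigma>))"
    using mult_left_mono[OF pv, of c] c by (simp add: frac_laplacian_def c_def E_def mult.assoc)
  \<comment> \<open>The nonlinearity has the sign of the fractional Laplacian, so an upper bound for
    the latter suffices.\<close>
  have nonlin: "\<bar>frac_laplacian \<sigma> u x\<bar> powr (p - 1) * frac_laplacian \<sigma> u x \<le> E powr p * \<rho> powr (- (2 * \<sigma> * p))"
  proof (cases "frac_laplacian \<sigma> u x \<le> 0")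
    case True
    then have "\<bar>frac_laplacian \<sigma> u x\<bar> powr (p - 1) * frac_laplacian \<sigma> u x \<le> 0" by (simp add: mult_nonneg_nonpos)
    also have "0 \<le> E powr p * \<rho> powr (- (2 * \<sigma> * p))" by simp
    finally show ?thesis .
  next
    case False
    then have "\<bar>frac_laplacian \<sigma> u x\<bar> powr (p - 1) * frac_laplacian \<sigma> u x = frac_laplacian \<sigma> u x powr p"
      by (simp add: powr_diff)
    also have "\<dots> \<le> (E * \<rho> powr (- (2 * \<sigma>))) powr p"
      using fl False p by (intro powr_mono2) auto
    also have "\<dots> = E powr p * \<rho> powr (- (2 * \<sigma> * p))" using E by (simp add: powr_mult powr_powr)
    finally show ?thesis .
  qed
  define d' where "d' = infdist x (frontier \<Omega>)"
  \<comment> \<open>The distance to the boundary is 1-Lipschitz, so at \<open>x\<close> it is at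
    most \<open>d + \<rho> = 3 * \<rho>\<close>.\<close>
  have d': "0 \<le> d'" "d' \<le> 3 * \<rho>"
    using infdist_triangle[of x "frontier \<Omega>" x\<^sub>0] x(1) by (auto simp: d'_def \<rho>_def d_def infdist_nonneg dist_commute)
  have fx: "\<kappa> \<le> d'\<^sup>2 * f x" using x(2) by (simp add: P_def d'_def)
  \<comment> \<open>The sign is needed to replace the squared distance by the larger
    \<open>(3 * \<rho>)\<^sup>2\<close>.\<close>
  have "f x \<ge> 0" using fx \<open>\<kappa> > 0\<close> by (smt (verit) mult_nonneg_nonpos zero_le_power2)
  then have "\<kappa> \<le> (3 * \<rho>)\<^sup>2 * f x"
    using fx d' by (smt (verit) mult_right_mono power_mono)
  also have "\<dots> \<le> (3 * \<rho>)\<^sup>2 * (N * (3 * (\<epsilon> / \<rho>\<^sup>2)) + E powr p * \<rho> powr (- (2 * \<sigma> * p)))"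
    using x(2) lap nonlin unfolding P_def by (intro mult_left_mono) auto
  also have "\<dots> = 27 * N * \<epsilon> + 9 * (E powr p * \<rho> powr (2 - 2 * \<sigma> * p))"
    using \<rho>(1) by (simp add: powr_diff powr_minus field_simps power2_eq_square)
  \<comment> \<open>Each of the two terms accounts for \<open>\<kappa> / 2\<close>, and the
    inequality is strict in the second.\<close>
  also have "\<dots> < 27 * N * \<epsilon> + 9 * (\<kappa> / 18)" using \<rho>\<^sub>0(2)[OF \<rho>(1,3)] by simp
  also have "\<dots> = \<kappa>" using N by (simp add: \<epsilon>_def)
  finally show False by simp
qed

end
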